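(* Let $\Omega=(-1,1)$, let $a,c\in L^\infty(\Omega)$ with $a(x)>0$ and $c(x)\ge 0$ for $x\in\Omega$, let $\mathcal{L}u=-(a(x)u'(x))'+c(x)u$ with bilinear form $\mathcal{B}:\mathcal{H}^1_0(\Omega)\times\mathcal{H}^1_0(\Omega)\to\mathbb{R}$, and let $f\in L^2(\Omega)$. Let $\mathcal{R}$ be an operator preconditioner that is bounded, is a smoother, and is a preconditioner for the Laplacian (as defined in the context), and suppose that $\mathcal{R}^*f\in\mathcal{W}_0$. Let $u_0=0,u_1,u_2,\ldots$ be the iterates of the preconditioned CG method described in the context. Then $$\|u-u_k\|_{\mathcal{L}}\le 2\left(\frac{\sqrt{\kappa_{\mathcal{W}_0}(\mathcal{T})}-1}{\sqrt{\kappa_{\mathcal{W}_0}(\mathcal{T})}+1}\right)^{k}\|u\|_{\mathcal{L}},\qquad k\ge 0,$$ where $\mathcal{T}=\Pi_{\mathcal{W}_0}^*\mathcal{R}^*\mathcal{L}\mathcal{R}\Pi_{\mathcal{W}_0}$ and $u$ is the exact solution of $\mathcal{L}u=f$ on $\Omega$, $u(\pm1)=0$.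
   Context: All functions are real-valued; $\langle\cdot,\cdot\rangle$ and $\|\cdot\|$ are the $L^2(\Omega)$ inner product and norm. $\mathcal{H}^1(\Omega),\mathcal{H}^2(\Omega),\mathcal{H}^1_0(\Omega)$ are the usual Sobolev spaces. Bilinear form and energy norm: $\mathcal{B}[\phi,\psi]=\int_{-1}^1 a\phi'\psi'+c\phi\psi\,dx$ for $\phi,\psi\in\mathcal{H}^1_0(\Omega)$, and $\|\phi\|_{\mathcal{L}}^2=\mathcal{B}[\phi,\phi]$. The weak form of the boundary value problem is $\mathcal{B}[u,\psi]=\langle f,\psi\rangle$ for all $\psi\in\mathcal{H}^1_0(\Omega)$. Operator preconditioner: a linear operator $\mathcal{R}:L^2(\Omega)\to L^2(\Omega)$, with $L^2$-adjoint $\mathcal{R}^*$, satisfying: (Bounded) $\sup_{\phi\in L^2(\Omega),\|\phi\|=1}\|\mathcal{R}\phi\|<\infty$; (Smoother) both $\mathcal{R}$ and $\mathcal{R}^*$ map $L^2(\Omega)$ into $\mathcal{H}^1(\Omega)$ and $\mathcal{H}^1(\Omega)$ into $\mathcal{H}^2(\Omega)$; (Preconditioner for the Laplacian) there are constants $0<\gamma_0\le\gamma_1<\infty$ with $\gamma_0\|\phi\|^2\le\|(\mathcal{R}\phi)'\|^2\le\gamma_1\|\phi\|^2$ for all $\phi\in L^2(\Omega)$. $\mathcal{W}_0=\{\phi\in L^2(\Omega):\mathcal{R}\phi\in\mathcal{H}^1_0(\Omega)\}$, and $\Pi_{\mathcal{W}_0}:L^2(\Omega)\to\mathcal{W}_0$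 is the $L^2$-orthogonal projection onto $\mathcal{W}_0$, with adjoint $\Pi_{\mathcal{W}_0}^*$. The operator $\mathcal{T}$ is understood weakly: $\langle\mathcal{T}\phi,\psi\rangle=\mathcal{B}[\mathcal{R}\Pi_{\mathcal{W}_0}\phi,\mathcal{R}\Pi_{\mathcal{W}_0}\psi]$ for $\phi,\psi\in L^2(\Omega)$. Its restricted condition number, which equals that of $\mathcal{R}^*\mathcal{L}\mathcal{R}$ on $\mathcal{W}_0$, is $$\kappa_{\mathcal{W}_0}(\mathcal{T})=\frac{\sup_{\phi\in\mathcal{W}_0,\|\phi\|=1}\mathcal{B}[\mathcal{R}\phi,\mathcal{R}\phi]}{\inf_{\phi\in\mathcal{W}_0,\|\phi\|=1}\mathcal{B}[\mathcal{R}\phi,\mathcal{R}\phi]}.$$ Preconditioned CG method (with $u_k=\mathcal{R}v_k$ approximating $u$): set $v_0=0$, $u_0=0$, $r_0=\mathcal{R}^*f$, $p_0=\mathcal{R}^*f$. For $k=0,1,\ldots$ (until converged): $\alpha_k=\langle r_k,r_k\rangle/\mathcal{B}[\mathcal{R}p_k,\mathcal{R}p_k]$; $v_{k+1}=v_k+\alpha_kp_k$; $r_{k+1}=r_k-\alpha_k\mathcal{T}p_k$; $\beta_k=\langle r_{k+1},r_{k+1}\rangle/\langle r_k,r_k\rangle$; $p_{k+1}=r_{k+1}+\beta_kp_k$; $u_{k+1}=\mathcal{R}v_{k+1}$.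
   Formalization: The formal theorem adds the hypothesis that the exact solution satisfies u = Rv for some v in W_0; without it the bound fails for some preconditioners whose range R(W_0) does not contain u. For infinite condition number the factor is read as 1. *)

theory Defs
  imports "HOL-Analysis.Analysis"
begin

text \<open>
  Elements of \<open>L\<^sup>2(-1,1)\<close> are represented by functions \<open>real \<Rightarrow> real\<close>, of which only the
  values on \<open>(-1,1)\<close> matter, and only up to null sets: \<open>ae_eq\<close> is equality in \<open>L\<^sup>2\<close>.
\<close>

abbreviation Omega :: "real set" where
  "Omega \<equiv> {-1<..<1}"

definition ae_eq :: "(real \<Rightarrow> real) \<Rightarrow> (real \<Rightarrow> real) \<Rightarrow> bool" where
  "ae_eq \<phi> \<psi> \<longleftrightarrow> (AE x in lebesgue_on Omega. \<phi> x = \<psi> x)"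

definition L2 :: "(real \<Rightarrow> real) set" where
  "L2 = {\<phi>. \<phi> \<in> borel_measurable (lebesgue_on Omega)
           \<and> integrable (lebesgue_on Omega) (\<lambda>x. (\<phi> x)\<^sup>2)}"

definition Linf :: "(real \<Rightarrow> real) set" where
  "Linf = {\<phi>. \<phi> \<in> borel_measurable (lebesgue_on Omega)
             \<and> (\<exists>C. AE x in lebesgue_on Omega. \<bar>\<phi> x\<bar> \<le> C)}"

definition ip :: "(real \<Rightarrow> real) \<Rightarrow> (real \<Rightarrow> real) \<Rightarrow> real" where
  "ip \<phi> \<psi> = (LINT x|lebesgue_on Omega. \<phi> x * \<psi> x)"

definition L2norm :: "(real \<Rightarrow> real) \<Rightarrow> real" where
  "L2norm \<phi> = sqrt (ip \<phi> \<phi>)"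

definition test_functions :: "(real \<Rightarrow> real) set" where
  "test_functions = {\<eta>. (\<forall>n x. (deriv ^^ n) \<eta> field_differentiable at x)
                      \<and> closure {x. \<eta> x \<noteq> 0} \<subseteq> Omega}"

definition has_weak_deriv :: "(real \<Rightarrow> real) \<Rightarrow> (real \<Rightarrow> real) \<Rightarrow> bool" where
  "has_weak_deriv \<phi> g \<longleftrightarrow> (\<forall>\<eta>\<in>test_functions. ip \<phi> (deriv \<eta>) = - ip g \<eta>)"

definition H1 :: "(real \<Rightarrow> real) set" where
  "H1 = {\<phi> \<in> L2. \<exists>g\<in>L2. has_weak_deriv \<phi> g}"

text \<open>A representative of the weak derivative, which is unique up to null sets.\<close>

definition wderiv :: "(real \<Rightarrow> real) \<Rightarrow> real \<Rightarrow> real" where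
  "wderiv \<phi> = (SOME g. g \<in> L2 \<and> has_weak_deriv \<phi> g)"

definition H2 :: "(real \<Rightarrow> real) set" where
  "H2 = {\<phi> \<in> H1. wderiv \<phi> \<in> H1}"

definition H1norm :: "(real \<Rightarrow> real) \<Rightarrow> real" where
  "H1norm \<phi> = sqrt ((L2norm \<phi>)\<^sup>2 + (L2norm (wderiv \<phi>))\<^sup>2)"

text \<open>The closure of the test functions in the \<open>H1\<close> norm.\<close>

definition H10 :: "(real \<Rightarrow> real) set" where
  "H10 = {\<phi> \<in> H1. \<forall>\<epsilon>>0. \<exists>\<eta>\<in>test_functions. H1norm (\<lambda>x. \<phi> x - \<eta> x) < \<epsilon>}"

definition bform ::
    "(real \<Rightarrow> real) \<Rightarrow> (real \<Rightarrow> real) \<Rightarrow> (real \<Rightarrow> real) \<Rightarrow> (real \<Rightarrow> real) \<Rightarrow> real" where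
  "bform a c \<phi> \<psi> = (LINT x|lebesgue_on Omega. a x * wderiv \<phi> x * wderiv \<psi> x + c x * \<phi> x * \<psi> x)"

definition energy_norm ::
    "(real \<Rightarrow> real) \<Rightarrow> (real \<Rightarrow> real) \<Rightarrow> (real \<Rightarrow> real) \<Rightarrow> real" where
  "energy_norm a c \<phi> = sqrt (bform a c \<phi> \<phi>)"

definition weak_solution ::
    "(real \<Rightarrow> real) \<Rightarrow> (real \<Rightarrow> real) \<Rightarrow> (real \<Rightarrow> real) \<Rightarrow> (real \<Rightarrow> real) \<Rightarrow> bool" where
  "weak_solution a c f u \<longleftrightarrow> u \<in> H10 \<and> (\<forall>\<psi>\<in>H10. bform a c u \<psi> = ip f \<psi>)"

text \<open>Linear maps of \<open>L\<^sup>2\<close> into itself; the second conjunct says that the map is well defined on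
  classes of almost everywhere equal functions.\<close>

definition linear_op :: "((real \<Rightarrow> real) \<Rightarrow> (real \<Rightarrow> real)) \<Rightarrow> bool" where
  "linear_op R \<longleftrightarrow>
     (\<forall>\<phi>\<in>L2. R \<phi> \<in> L2)
   \<and> (\<forall>\<phi>\<in>L2. \<forall>\<psi>\<in>L2. ae_eq \<phi> \<psi> \<longrightarrow> ae_eq (R \<phi>) (R \<psi>))
   \<and> (\<forall>\<phi>\<in>L2. \<forall>\<psi>\<in>L2. ae_eq (R (\<lambda>x. \<phi> x + \<psi> x)) (\<lambda>x. R \<phi> x + R \<psi> x))
   \<and> (\<forall>s. \<forall>\<phi>\<in>L2. ae_eq (R (\<lambda>x. s * \<phi> x)) (\<lambda>x. s * R \<phi> x))"

definition is_adjoint ::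
    "((real \<Rightarrow> real) \<Rightarrow> (real \<Rightarrow> real)) \<Rightarrow> ((real \<Rightarrow> real) \<Rightarrow> (real \<Rightarrow> real)) \<Rightarrow> bool" where
  "is_adjoint R Rs \<longleftrightarrow>
     (\<forall>\<psi>\<in>L2. Rs \<psi> \<in> L2) \<and> (\<forall>\<phi>\<in>L2. \<forall>\<psi>\<in>L2. ip (R \<phi>) \<psi> = ip \<phi> (Rs \<psi>))"

definition bounded_op :: "((real \<Rightarrow> real) \<Rightarrow> (real \<Rightarrow> real)) \<Rightarrow> bool" where
  "bounded_op R \<longleftrightarrow> bdd_above {L2norm (R \<phi>) |\<phi>. \<phi> \<in> L2 \<and> L2norm \<phi> = 1}"

definition smoother ::
    "((real \<Rightarrow> real) \<Rightarrow> (real \<Rightarrow> real)) \<Rightarrow> ((real \<Rightarrow> real) \<Rightarrow> (real \<Rightarrow> real)) \<Rightarrow> bool" where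
  "smoother R Rs \<longleftrightarrow> R ` L2 \<subseteq> H1 \<and> Rs ` L2 \<subseteq> H1 \<and> R ` H1 \<subseteq> H2 \<and> Rs ` H1 \<subseteq> H2"

definition laplacian_preconditioner :: "((real \<Rightarrow> real) \<Rightarrow> (real \<Rightarrow> real)) \<Rightarrow> bool" where
  "laplacian_preconditioner R \<longleftrightarrow>
     (\<exists>\<gamma>0 \<gamma>1. 0 < \<gamma>0 \<and> \<gamma>0 \<le> \<gamma>1
        \<and> (\<forall>\<phi>\<in>L2. \<gamma>0 * (L2norm \<phi>)\<^sup>2 \<le> (L2norm (wderiv (R \<phi>)))\<^sup>2
                 \<and> (L2norm (wderiv (R \<phi>)))\<^sup>2 \<le> \<gamma>1 * (L2norm \<phi>)\<^sup>2))"

definition W0 :: "((real \<Rightarrow> real) \<Rightarrow> (real \<Rightarrow> real)) \<Rightarrow> (real \<Rightarrow> real) set" where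
  "W0 R = {\<phi> \<in> L2. R \<phi> \<in> H10}"

definition is_orth_proj :: "(real \<Rightarrow> real) set \<Rightarrow> ((real \<Rightarrow> real) \<Rightarrow> (real \<Rightarrow> real)) \<Rightarrow> bool" where
  "is_orth_proj W P \<longleftrightarrow>
     (\<forall>\<phi>\<in>L2. P \<phi> \<in> W \<and> (\<forall>\<psi>\<in>W. ip (\<lambda>x. \<phi> x - P \<phi> x) \<psi> = 0))"

text \<open>The weak meaning of \<open>T = P\<^sup>* R\<^sup>* L R P\<close>; it determines \<open>T\<close> up to null sets.\<close>

definition is_precond_op ::
    "(real \<Rightarrow> real) \<Rightarrow> (real \<Rightarrow> real) \<Rightarrow> ((real \<Rightarrow> real) \<Rightarrow> (real \<Rightarrow> real))
      \<Rightarrow> ((real \<Rightarrow> real) \<Rightarrow> (real \<Rightarrow> real)) \<Rightarrow> ((real \<Rightarrow> real) \<Rightarrow> (real \<Rightarrow> real)) \<Rightarrow> bool" where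
  "is_precond_op a c R P T \<longleftrightarrow>
     (\<forall>\<phi>\<in>L2. T \<phi> \<in> L2)
   \<and> (\<forall>\<phi>\<in>L2. \<forall>\<psi>\<in>L2. ip (T \<phi>) \<psi> = bform a c (R (P \<phi>)) (R (P \<psi>)))"

text \<open>The quotient is taken in the extended reals because the infimum may be \<open>0\<close> (the coefficient
  \<open>a\<close> is positive but need not be bounded away from \<open>0\<close>); the condition number is then \<open>\<infinity>\<close>.\<close>

definition restricted_cond ::
    "(real \<Rightarrow> real) \<Rightarrow> (real \<Rightarrow> real) \<Rightarrow> ((real \<Rightarrow> real) \<Rightarrow> (real \<Rightarrow> real)) \<Rightarrow> ereal" where
  "restricted_cond a c R =
     (SUP \<phi>\<in>{\<phi> \<in> W0 R. L2norm \<phi> = 1}. ereal (bform a c (R \<phi>) (R \<phi>)))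
   / (INF \<phi>\<in>{\<phi> \<in> W0 R. L2norm \<phi> = 1}. ereal (bform a c (R \<phi>) (R \<phi>)))"

text \<open>For \<open>\<kappa> = \<infinity>\<close> the factor is read as its limit \<open>1\<close>.\<close>

definition cg_factor :: "ereal \<Rightarrow> real" where
  "cg_factor \<kappa> =
     (if \<kappa> = \<infinity> then 1
      else (sqrt (real_of_ereal \<kappa>) - 1) / (sqrt (real_of_ereal \<kappa>) + 1))"

text \<open>
  The triple \<open>(v\<^sub>k, r\<^sub>k, p\<^sub>k)\<close>. Once \<open>r\<^sub>k = 0\<close> the method has converged; since \<open>0 / 0 = 0\<close> in HOL,
  the recursion then continues with constant \<open>v\<^sub>k\<close> (up to null sets).
\<close>

primrec pcg ::
    "(real \<Rightarrow> real) \<Rightarrow> (real \<Rightarrow> real) \<Rightarrow> ((real \<Rightarrow> real) \<Rightarrow> (real \<Rightarrow> real))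
      \<Rightarrow> ((real \<Rightarrow> real) \<Rightarrow> (real \<Rightarrow> real)) \<Rightarrow> ((real \<Rightarrow> real) \<Rightarrow> (real \<Rightarrow> real))
      \<Rightarrow> (real \<Rightarrow> real) \<Rightarrow> nat \<Rightarrow> (real \<Rightarrow> real) \<times> (real \<Rightarrow> real) \<times> (real \<Rightarrow> real)" where
  "pcg a c R Rs T f 0 = ((\<lambda>x. 0), Rs f, Rs f)"
| "pcg a c R Rs T f (Suc k) =
     (let (v, r, p) = pcg a c R Rs T f k;
          \<alpha> = ip r r / bform a c (R p) (R p);
          v' = (\<lambda>x. v x + \<alpha> * p x);
          r' = (\<lambda>x. r x - \<alpha> * T p x);
          \<beta> = ip r' r' / ip r r;
          p' = (\<lambda>x. r' x + \<beta> * p x)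
      in (v', r', p'))"

definition pcg_iterate ::
    "(real \<Rightarrow> real) \<Rightarrow> (real \<Rightarrow> real) \<Rightarrow> ((real \<Rightarrow> real) \<Rightarrow> (real \<Rightarrow> real))
      \<Rightarrow> ((real \<Rightarrow> real) \<Rightarrow> (real \<Rightarrow> real)) \<Rightarrow> ((real \<Rightarrow> real) \<Rightarrow> (real \<Rightarrow> real))
      \<Rightarrow> (real \<Rightarrow> real) \<Rightarrow> nat \<Rightarrow> real \<Rightarrow> real" where
  "pcg_iterate a c R Rs T f k = (if k = 0 then (\<lambda>x. 0) else R (fst (pcg a c R Rs T f k)))"

end

theory Submission
  imports Defs
begin

text \<open>
  On the subspace \<open>W\<^sub>0\<close> the method is plain CG for \<open>T v = R\<^sup>* f\<close> with the bounded symmetric positive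
  operator \<open>T\<close>, and the energy norm of \<open>R \<phi>\<close> is the \<open>T\<close>-norm of \<open>\<phi>\<close>. The CG error is \<open>T\<close>-orthogonal
  to the Krylov space, hence minimal among all \<open>q(T) e\<close> with \<open>deg q \<le> k\<close> and \<open>q(0) = 1\<close>. The
  shifted Chebyshev polynomial is bounded without spectral theory: by the Pell identity
  \<open>1 - T\<^sub>k(s)\<^sup>2 = (1 - s\<^sup>2) U\<^bsub>k-1\<^esub>(s)\<^sup>2\<close> it suffices that \<open>(T - m) (M - T)\<close> is positive, which is elementary.
\<close>

subsection \<open>Conjugate gradients in an inner product space\<close>

text \<open>The coefficient \<open>a\<close> is positive but has no positive lower bound, so
  \<open>m\<close>, later the infimum of the form over the unit sphere of \<open>W0\<close>, may be
  0; this is why \<open>T_definite\<close> stands beside the two bounds. For the same reason the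
  rate is written as (sqrt M - sqrt m) / (sqrt M + sqrt m), and the Chebyshev recursion is kept
  homogeneous in \<open>M\<close> and \<open>m\<close>: it divides neither by \<open>m\<close> nor
  by \<open>M - m\<close>. The error is measured in the form \<open>T x \<bullet> x\<close>, so
  every positivity statement below carries one more factor \<open>T\<close>. On the concrete side
  the operators \<open>P\<close> and \<open>T\<close> are known only through inner products of
  representatives. Their linearity and their independence of the representative are both extracted
  from symmetry, on the quotient by null functions. The hypothesis \<open>u_range\<close> writes the
  solution as \<open>R w\<close> with \<open>w\<close> in \<open>W0\<close>; this places the initial
  error in the same space as the iterates.\<close>

locale spectral_bounds =
  fixes T :: "'a::real_inner \<Rightarrow> 'a" and V :: "'a set" and m M :: real
  assumes linear_T: "linear T"
    and T_sym: "\<And>x y. T x \<bullet> y = x \<bullet> T y"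
    and subspace_V: "subspace V"
    and T_V: "\<And>x. x \<in> V \<Longrightarrow> T x \<in> V"
    and m_nonneg: "0 \<le> m" and M_pos: "0 < M"
    and T_ge: "\<And>x. x \<in> V \<Longrightarrow> m * (x \<bullet> x) \<le> T x \<bullet> x"
    and T_le: "\<And>x. x \<in> V \<Longrightarrow> T x \<bullet> x \<le> M * (x \<bullet> x)"
    and T_definite: "\<And>x. x \<in> V \<Longrightarrow> T x \<bullet> x = 0 \<Longrightarrow> x = 0"
begin

lemmas T_add = linear_add[OF linear_T]
  and T_diff = linear_diff[OF linear_T]
  and T_scaleR = linear_scale[OF linear_T]
  and T_zero = linear_0[OF linear_T]

lemmas V_intros = subspace_add[OF subspace_V] subspace_diff[OF subspace_V]
  subspace_scale[OF subspace_V] subspace_0[OF subspace_V] T_V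

section \<open>Positivity of products of commuting operators\<close>

lemma T_nonneg: "x \<in> V \<Longrightarrow> 0 \<le> T x \<bullet> x"
  using T_ge[of x] m_nonneg by (smt (verit) inner_ge_zero mult_nonneg_nonneg)

text \<open>T (T - m) = (T - m)^2 + m (T - m), and both terms have a nonnegative form.\<close>

lemma T_minus_lower_nonneg:
  assumes "x \<in> V"
  shows "0 \<le> T (T x - m *\<^sub>R x) \<bullet> x"
proof -
  let ?y = "T x - m *\<^sub>R x"
  have "T ?y \<bullet> x = ?y \<bullet> ?y + m * (T x \<bullet> x - m * (x \<bullet> x))"
    by (simp add: T_sym T_diff T_scaleR inner_diff_right inner_diff_left inner_commute)
      (simp add: algebra_simps)
  then show ?thesis
    using T_ge[OF assms] m_nonneg by simp
qed

text \<open>Square roots of operators are avoided by M T (M - T) = T (M - T) T + (M - T) T (M - T):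
  each term conjugates a positive operator by a symmetric one.\<close>

lemma upper_minus_T_nonneg:
  assumes "x \<in> V"
  shows "0 \<le> T (M *\<^sub>R x - T x) \<bullet> x"
proof -
  let ?y = "M *\<^sub>R x - T x"
  have "M * (T ?y \<bullet> x) = (M * (T x \<bullet> T x) - T (T x) \<bullet> T x) + T ?y \<bullet> ?y"
    by (simp add: T_sym T_diff T_scaleR inner_diff_right inner_diff_left inner_commute)
      (simp add: algebra_simps)
  moreover have "0 \<le> T ?y \<bullet> ?y" using assms by (intro T_nonneg V_intros)
  moreover have "T (T x) \<bullet> T x \<le> M * (T x \<bullet> T x)" using assms by (intro T_le V_intros)
  ultimately have "0 \<le> M * (T ?y \<bullet> x)" by linarith
  then show ?thesis using M_pos by (simp add: zero_le_mult_iff)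
qed

text \<open>This is the degenerate case in which the prefactor M - m of the next argument vanishes.
  The quadratic form of T - m is zero on \<open>V\<close>; polarizing it at \<open>x\<close> and T x
  - m x gives the claim.\<close>

lemma T_eq_scaleR_if_bounds_eq:
  assumes "m = M" "x \<in> V"
  shows "T x = m *\<^sub>R x"
proof -
  let ?y = "T x - m *\<^sub>R x"
  have quad: "T z \<bullet> z = m * (z \<bullet> z)" if "z \<in> V" for z
    using T_ge[OF that] T_le[OF that] assms(1) by simp
  have y: "?y \<in> V" using assms(2) by (intro V_intros)
  have "T (x + ?y) \<bullet> (x + ?y) = m * ((x + ?y) \<bullet> (x + ?y))"
    using y assms(2) by (intro quad V_intros)
  moreover have "T (x + ?y) \<bullet> (x + ?y) = T x \<bullet> x + 2 * (T x \<bullet> ?y) + T ?y \<bullet> ?y"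
    by (simp only: T_add inner_add_left inner_add_right T_sym[of ?y x])
      (simp add: inner_commute)
  moreover have "(x + ?y) \<bullet> (x + ?y) = x \<bullet> x + 2 * (x \<bullet> ?y) + ?y \<bullet> ?y"
    by (simp only: inner_add_left inner_add_right) (simp add: inner_commute)
  ultimately have "2 * (T x \<bullet> ?y) = 2 * (m * (x \<bullet> ?y))"
    using quad[OF y] quad[OF assms(2)] by (simp add: distrib_left)
  then have "?y \<bullet> ?y = 0" by (simp add: inner_diff_left)
  then show ?thesis by simp
qed

text \<open>With A = T - m and C = M - T, the sum A + C is the scalar M - m, so (M - m) T A C = A (T
  C) A + C (T A) C. The two preceding lemmas cover T C and T A.\<close>

lemma spectral_product_nonneg:
  assumes "x \<in> V"
  shows "0 \<le> T (T (M *\<^sub>R x - T x) - m *\<^sub>R (M *\<^sub>R x - T x)) \<bullet> x"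
proof (cases "m = M")
  case True
  have "M *\<^sub>R x - T x = 0" using T_eq_scaleR_if_bounds_eq[OF True assms] True by simp
  then show ?thesis by (simp add: T_zero)
next
  case False
  let ?A = "\<lambda>x. T x - m *\<^sub>R x" and ?C = "\<lambda>x. M *\<^sub>R x - T x"
  \<comment> \<open>The order of the bounds is not part of the locale; bounds in the wrong order
    force \<open>V\<close> to be trivial.\<close>
  have "x = 0" if "M < m"
  proof -
    have "m * (x \<bullet> x) \<le> M * (x \<bullet> x)" using T_ge[OF assms] T_le[OF assms] by linarith
    then have "x \<bullet> x \<le> 0" using that by (meson mult_le_cancel_right not_less)
    then show ?thesis by (metis inner_ge_zero inner_eq_zero_iff order_antisym)
  qed
  moreover have ?thesis if "m < M"
  proof -
    have "(M - m) * (T (?A (?C x)) \<bullet> x) = T (?C (?A x)) \<bullet> ?A x + T (?A (?C x)) \<bullet> ?C x"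
      by (simp add: T_diff T_scaleR inner_diff_right inner_diff_left T_sym inner_commute)
        (simp add: algebra_simps)
    moreover have "0 \<le> T (?C (?A x)) \<bullet> ?A x"
      using assms by (intro upper_minus_T_nonneg V_intros)
    moreover have "0 \<le> T (?A (?C x)) \<bullet> ?C x"
      using assms by (intro T_minus_lower_nonneg V_intros)
    ultimately have "0 \<le> (M - m) * (T (?A (?C x)) \<bullet> x)" by linarith
    then show ?thesis using that by (simp add: zero_le_mult_iff)
  qed
  ultimately show ?thesis using False by (cases "m < M") (auto simp: T_zero)
qed


text \<open>With \<open>S = M + m - 2 T\<close> and \<open>L = M - m\<close>, the pair is \<open>x = L\<^sup>n T\<^sub>n(S/L) e\<close> and
  \<open>y = L\<^bsup>n-1\<^esup> U\<^bsub>n-1\<^esub>(S/L) e\<close> for the Chebyshev polynomials \<open>T\<^sub>n, U\<^sub>n\<close>; the scalars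
  \<open>\<tau>, \<upsilon>\<close> are the values of the same polynomials at \<open>T = 0\<close>.\<close>

lemma chebyshev_pair_exists:
  fixes K :: "nat \<Rightarrow> 'a set" and e :: 'a
  assumes e: "e \<in> V"
    and sub: "\<And>n. subspace (K n)" and mono: "\<And>n. K n \<subseteq> K (Suc n)"
    and T_K: "\<And>n x. x \<in> K n \<Longrightarrow> T x \<in> K (Suc n)" and Te: "T e \<in> K 1"
  defines "S \<equiv> \<lambda>x. (M + m) *\<^sub>R x - 2 *\<^sub>R T x"
  defines "D \<equiv> \<lambda>x. (M - m)\<^sup>2 *\<^sub>R x - S (S x)"
  shows "\<exists>x y \<tau> \<upsilon>. x \<in> V \<and> y \<in> V
     \<and> T x \<bullet> x + T (D y) \<bullet> y = (M - m) ^ (2 * n) * (T e \<bullet> e)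
     \<and> x - \<tau> *\<^sub>R e \<in> K n \<and> y - \<upsilon> *\<^sub>R e \<in> K n \<and> S y - ((M + m) * \<upsilon>) *\<^sub>R e \<in> K n
     \<and> \<tau> + 2 * sqrt (M * m) * \<upsilon> = (sqrt M + sqrt m) ^ (2 * n)
     \<and> \<tau> - 2 * sqrt (M * m) * \<upsilon> = (sqrt M - sqrt m) ^ (2 * n)"
proof (induction n)
  case 0
  show ?case
    using e sub[of 0]
    by (intro exI[of _ e] exI[of _ 0] exI[of _ 1])
      (auto simp: S_def D_def T_zero subspace_0 V_intros)
next
  case (Suc n)
  then obtain x y \<tau> \<upsilon> where xy: "x \<in> V" "y \<in> V"
    and quad: "T x \<bullet> x + T (D y) \<bullet> y = (M - m) ^ (2 * n) * (T e \<bullet> e)"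
    and x: "x - \<tau> *\<^sub>R e \<in> K n" and y: "y - \<upsilon> *\<^sub>R e \<in> K n"
    and Sy: "S y - ((M + m) * \<upsilon>) *\<^sub>R e \<in> K n"
    and plus: "\<tau> + 2 * sqrt (M * m) * \<upsilon> = (sqrt M + sqrt m) ^ (2 * n)"
    and minus: "\<tau> - 2 * sqrt (M * m) * \<upsilon> = (sqrt M - sqrt m) ^ (2 * n)"
    by blast
  note T_lin = T_add T_diff T_scaleR
  have S_V: "S z \<in> V" if "z \<in> V" for z unfolding S_def using that by (intro V_intros)
  have D_V: "D z \<in> V" if "z \<in> V" for z unfolding D_def using that by (intro V_intros S_V)
  have Te_K: "T e \<in> K (Suc j)" for j
    using Te mono by (induction j) auto
  have S_K: "S z - ((M + m) * s) *\<^sub>R e \<in> K (Suc j)" if "z - s *\<^sub>R e \<in> K j" for z s j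
  proof -
    have "S z - ((M + m) * s) *\<^sub>R e
        = (M + m) *\<^sub>R (z - s *\<^sub>R e) - 2 *\<^sub>R T (z - s *\<^sub>R e) - (2 * s) *\<^sub>R T e"
      by (simp add: S_def T_lin algebra_simps)
    moreover have "\<dots> \<in> K (Suc j)"
      by (rule subspace_diff[OF sub subspace_diff[OF sub subspace_scale[OF sub subsetD[OF mono that]]
            subspace_scale[OF sub T_K[OF that]]] subspace_scale[OF sub Te_K]])
    ultimately show ?thesis by simp
  qed
  \<comment> \<open>The recurrences T_{n+1}(s) = s T_n(s) - (1 - s^2) U_{n-1}(s) and U_n(s) = T_n(s)
    + s U_{n-1}(s) at s = S/L, multiplied by L^{n+1} and L^n.\<close>
  define x' where "x' = S x - D y"
  define y' where "y' = x + S y"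
  define \<sigma> where "\<sigma> = M + m"
  \<comment> \<open>At T = 0 the operator \<open>S\<close> becomes M + m and \<open>D\<close>
    becomes (M - m)^2 - (M + m)^2 = -4 M m.\<close>
  define \<tau>' where "\<tau>' = \<sigma> * \<tau> + 4 * M * m * \<upsilon>"
  define \<upsilon>' where "\<upsilon>' = \<tau> + \<sigma> * \<upsilon>"
  have V': "x' \<in> V" "y' \<in> V" unfolding x'_def y'_def using xy by (auto intro!: V_intros S_V D_V)
  \<comment> \<open>Brahmagupta's identity (S x - D y)^2 + D (x + S y)^2 = (S^2 + D) (x^2 + D y^2),
    where S^2 + D = (M - m)^2. The cross terms cancel because \<open>S\<close> is symmetric for the
    form of \<open>T\<close>.\<close>
  have "T x' \<bullet> x' + T (D y') \<bullet> y' = (M - m)\<^sup>2 * (T x \<bullet> x + T (D y) \<bullet> y)"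
  proof -
    have S_lin: "S (u + w) = S u + S w" "S (u - w) = S u - S w" "S (s *\<^sub>R u) = s *\<^sub>R S u" for u w s
      by (simp_all add: S_def T_lin algebra_simps)
    have S_sym: "T (S u) \<bullet> w = T u \<bullet> S w" for u w
      by (simp add: S_def T_lin inner_diff_left inner_diff_right T_sym)
    have comm: "T u \<bullet> w = T w \<bullet> u" for u w
      using T_sym[of u w] by (simp add: inner_commute)
    have swap: "T y \<bullet> x = T x \<bullet> y" "T y \<bullet> S x = T x \<bullet> S y" "T y \<bullet> S (S x) = T x \<bullet> S (S y)"
      "T y \<bullet> S (S (S x)) = T x \<bullet> S (S (S y))"
      using comm[of y x] comm[of "S y" x] comm[of "S (S y)" x] comm[of "S (S (S y))" x]
      by (simp_all add: S_sym)
    show ?thesis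
      unfolding x'_def y'_def D_def
      by (simp add: S_lin T_lin inner_add_left inner_add_right inner_diff_left inner_diff_right
          S_sym swap) (simp add: algebra_simps)
  qed
  then have quad': "T x' \<bullet> x' + T (D y') \<bullet> y' = (M - m) ^ (2 * Suc n) * (T e \<bullet> e)"
    by (simp add: quad power_add power2_eq_square algebra_simps)
  \<comment> \<open>The polynomial of \<open>y'\<close> has degree one less than that of
    \<open>x'\<close>. The separate invariant on \<open>S y\<close> records this gain without an
    index n - 1; applying \<open>S\<close> to membership of \<open>y\<close> in \<open>K n\<close>
    would lose one index.\<close>
  have y'_K: "y' - \<upsilon>' *\<^sub>R e \<in> K n"
  proof -
    have "y' - \<upsilon>' *\<^sub>R e = (x - \<tau> *\<^sub>R e) + (S y - ((M + m) * \<upsilon>) *\<^sub>R e)"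
      by (simp add: y'_def \<upsilon>'_def \<sigma>_def algebra_simps)
    then show ?thesis using x Sy sub by (simp add: subspace_add)
  qed
  have x'_K: "x' - \<tau>' *\<^sub>R e \<in> K (Suc n)"
  proof -
    have "x' - \<tau>' *\<^sub>R e = (S x - (\<sigma> * \<tau>) *\<^sub>R e) - (M - m)\<^sup>2 *\<^sub>R (y - \<upsilon> *\<^sub>R e)
        + (S (S y) - (\<sigma> * (\<sigma> * \<upsilon>)) *\<^sub>R e)"
      by (simp add: x'_def D_def \<tau>'_def \<sigma>_def algebra_simps power2_eq_square
          scaleR_left_distrib[symmetric] del: scaleR_left_distrib)
    moreover have "\<dots> \<in> K (Suc n)"
      unfolding \<sigma>_def
      by (rule subspace_add[OF sub subspace_diff[OF sub S_K[OF x]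
            subspace_scale[OF sub subsetD[OF mono y]]] S_K[OF Sy]])
    ultimately show ?thesis by simp
  qed
  \<comment> \<open>The linear recursion for (\<tau>, \<upsilon>) has the eigenvalues \<sigma> + 2
    sqrt (M m) and \<sigma> - 2 sqrt (M m), which are the squares of sqrt M + sqrt m and sqrt M -
    sqrt m.\<close>
  have sq: "sqrt (M * m) * sqrt (M * m) = M * m"
    using m_nonneg M_pos by simp
  have sqp: "(sqrt M + sqrt m)\<^sup>2 = \<sigma> + 2 * sqrt (M * m)" "(sqrt M - sqrt m)\<^sup>2 = \<sigma> - 2 * sqrt (M * m)"
    using m_nonneg M_pos by (simp_all add: power2_sum power2_diff \<sigma>_def real_sqrt_mult)
  have "(\<sigma> + 2 * sqrt (M * m)) * (\<tau> + 2 * sqrt (M * m) * \<upsilon>)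
      = \<sigma> * \<tau> + 4 * (sqrt (M * m) * sqrt (M * m)) * \<upsilon> + 2 * sqrt (M * m) * \<upsilon>'"
    unfolding \<upsilon>'_def by algebra
  then have plus': "\<tau>' + 2 * sqrt (M * m) * \<upsilon>' = (sqrt M + sqrt m) ^ (2 * Suc n)"
    by (simp only: sq sqp(1)[symmetric] plus power_add[symmetric] \<tau>'_def) simp
  have "(\<sigma> - 2 * sqrt (M * m)) * (\<tau> - 2 * sqrt (M * m) * \<upsilon>)
      = \<sigma> * \<tau> + 4 * (sqrt (M * m) * sqrt (M * m)) * \<upsilon> - 2 * sqrt (M * m) * \<upsilon>'"
    unfolding \<upsilon>'_def by algebra
  then have minus': "\<tau>' - 2 * sqrt (M * m) * \<upsilon>' = (sqrt M - sqrt m) ^ (2 * Suc n)"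
    by (simp only: sq sqp(2)[symmetric] minus power_add[symmetric] \<tau>'_def) simp
  show ?case
    using V' quad' x'_K y'_K mono[of n] S_K[OF y'_K] plus' minus'
    by (intro exI[of _ x'] exI[of _ y'] exI[of _ \<tau>'] exI[of _ \<upsilon>']) auto
qed

text \<open>The competitor is x / \<tau>, the Chebyshev polynomial normalized to 1 at T = 0. It
  differs from \<open>d\<close> by an element of \<open>K n\<close>, so Pythagoras in the form of
  \<open>T\<close> gives \<tau>^2 |d|^2 \<le> |x|^2, and the Pell identity bounds |x|^2.\<close>

lemma krylov_best_approximation:
  fixes K :: "nat \<Rightarrow> 'a set" and e d :: 'a
  assumes e: "e \<in> V" and d: "d \<in> V"
    and sub: "\<And>n. subspace (K n)" and mono: "\<And>n. K n \<subseteq> K (Suc n)" and K_V: "K n \<subseteq> V"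
    and T_K: "\<And>n x. x \<in> K n \<Longrightarrow> T x \<in> K (Suc n)" and Te: "T e \<in> K 1"
    and de: "d - e \<in> K n" and orth: "\<And>w. w \<in> K n \<Longrightarrow> T d \<bullet> w = 0"
  shows "sqrt (T d \<bullet> d)
    \<le> 2 * ((sqrt M - sqrt m) / (sqrt M + sqrt m)) ^ n * sqrt (T e \<bullet> e)"
proof -
  define S where "S = (\<lambda>x. (M + m) *\<^sub>R x - 2 *\<^sub>R T x)"
  define D where "D = (\<lambda>x. (M - m)\<^sup>2 *\<^sub>R x - S (S x))"
  obtain x y \<tau> \<upsilon> where xy: "x \<in> V" "y \<in> V"
    and quad: "T x \<bullet> x + T (D y) \<bullet> y = (M - m) ^ (2 * n) * (T e \<bullet> e)"
    and x: "x - \<tau> *\<^sub>R e \<in> K n"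
    and plus: "\<tau> + 2 * sqrt (M * m) * \<upsilon> = (sqrt M + sqrt m) ^ (2 * n)"
    and minus: "\<tau> - 2 * sqrt (M * m) * \<upsilon> = (sqrt M - sqrt m) ^ (2 * n)"
    using chebyshev_pair_exists[of e K n, OF e sub mono T_K Te] unfolding S_def D_def by blast
  define A where "A = (sqrt M + sqrt m) ^ n"
  define B where "B = (sqrt M - sqrt m) ^ n"
  define \<rho> where "\<rho> = (sqrt M - sqrt m) / (sqrt M + sqrt m)"
  have A_pos: "0 < A" unfolding A_def using m_nonneg M_pos by (simp add: add_pos_nonneg)
  have AB: "A * B = (M - m) ^ n"
    using m_nonneg M_pos by (simp add: A_def B_def power_mult_distrib[symmetric] algebra_simps)
  \<comment> \<open>The sum of the two identities is 2 \<tau> = A^2 + B^2. Dropping B^2 is what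
    produces the factor 2 in the final bound.\<close>
  have \<tau>: "A\<^sup>2 \<le> 2 * \<tau>"
    using plus minus zero_le_power2[of B] unfolding A_def B_def
    by (simp add: power_mult[symmetric] mult.commute)
  \<comment> \<open>L^2 - S^2 = (L - S) (L + S) with L = M - m, L - S = 2 (T - m) and L + S = 2 (M -
    T).\<close>
  have "D y = 4 *\<^sub>R (T (M *\<^sub>R y - T y) - m *\<^sub>R (M *\<^sub>R y - T y))"
    by (simp add: D_def S_def T_diff T_scaleR scaleR_right_diff_distrib power2_eq_square algebra_simps
        flip: scaleR_add_left)
  then have "0 \<le> T (D y) \<bullet> y"
    using spectral_product_nonneg[OF xy(2)] by (simp only: T_scaleR inner_scaleR_left)
  then have Tx: "T x \<bullet> x \<le> (A * B)\<^sup>2 * (T e \<bullet> e)"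
    using quad by (simp add: AB power_mult[symmetric] mult.commute)
  have "x - \<tau> *\<^sub>R d \<in> K n"
    using subspace_diff[OF sub x subspace_scale[OF sub de, of \<tau>]] by (simp add: algebra_simps)
  then obtain w where w: "w \<in> K n" "x = \<tau> *\<^sub>R d + w"
    by (metis add.commute diff_add_cancel)
  have "T x \<bullet> x = \<tau>\<^sup>2 * (T d \<bullet> d) + T w \<bullet> w"
    using orth[OF w(1)] T_sym[of w d]
    by (simp add: w(2) T_add T_scaleR inner_add_left inner_add_right power2_eq_square inner_commute)
  moreover have "0 \<le> T w \<bullet> w" using w(1) K_V by (intro T_nonneg) auto
  ultimately have "\<tau>\<^sup>2 * (T d \<bullet> d) \<le> (A * B)\<^sup>2 * (T e \<bullet> e)"
    using Tx by linarith
  moreover have "(A\<^sup>2)\<^sup>2 * (T d \<bullet> d) \<le> (2 * \<tau>)\<^sup>2 * (T d \<bullet> d)"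
    using \<tau> T_nonneg[OF d] by (intro mult_right_mono power_mono) auto
  ultimately have "A\<^sup>2 * (A\<^sup>2 * (T d \<bullet> d)) \<le> A\<^sup>2 * ((2 * B)\<^sup>2 * (T e \<bullet> e))"
    by (simp add: power2_eq_square algebra_simps)
  then have "A\<^sup>2 * (T d \<bullet> d) \<le> (2 * B)\<^sup>2 * (T e \<bullet> e)"
    using A_pos by (subst (asm) mult_le_cancel_left_pos) auto
  moreover have B: "B = \<rho> ^ n * A"
    using A_pos unfolding \<rho>_def A_def B_def
    by (metis nonzero_eq_divide_eq order_less_irrefl power_divide)
  ultimately have "A\<^sup>2 * (T d \<bullet> d) \<le> A\<^sup>2 * ((2 * \<rho> ^ n)\<^sup>2 * (T e \<bullet> e))"
    by (simp add: power_mult_distrib algebra_simps)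
  then have le: "T d \<bullet> d \<le> (2 * \<rho> ^ n)\<^sup>2 * (T e \<bullet> e)"
    using A_pos by (subst (asm) mult_le_cancel_left_pos) auto
  \<comment> \<open>A nonzero \<open>e\<close> forces m \<le> M; for e = 0 the sign of \<rho> does
    not matter.\<close>
  have "0 \<le> \<rho>" if "e \<noteq> 0"
  proof -
    have "m * (e \<bullet> e) \<le> M * (e \<bullet> e)" using T_ge[OF e] T_le[OF e] by linarith
    then have "m \<le> M" using that by simp
    then show ?thesis using m_nonneg M_pos unfolding \<rho>_def by (intro divide_nonneg_pos) (auto simp: add_pos_nonneg)
  qed
  then have "sqrt ((2 * \<rho> ^ n)\<^sup>2 * (T e \<bullet> e)) = 2 * \<rho> ^ n * sqrt (T e \<bullet> e)"
    by (cases "e = 0") (simp_all add: T_zero real_sqrt_mult)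
  then show ?thesis
    using real_sqrt_le_mono[OF le] by (simp add: \<rho>_def)
qed

text \<open>No stopping test is required: since 0 / 0 = 0, a vanishing residual makes the search
  direction and both coefficients vanish from then on, so the bound persists for every
  \<open>n\<close>.\<close>

lemma cg_error_bound:
  fixes v r p :: "nat \<Rightarrow> 'a" and \<alpha> \<beta> :: "nat \<Rightarrow> real"
  assumes e: "e \<in> V"
    and v0: "v 0 = 0" and r0: "r 0 = T e" and p0: "p 0 = T e"
    and \<alpha>: "\<And>k. \<alpha> k = (r k \<bullet> r k) / (T (p k) \<bullet> p k)"
    and v_Suc: "\<And>k. v (Suc k) = v k + \<alpha> k *\<^sub>R p k"
    and r_Suc: "\<And>k. r (Suc k) = r k - \<alpha> k *\<^sub>R T (p k)"
    and \<beta>: "\<And>k. \<beta> k = (r (Suc k) \<bullet> r (Suc k)) / (r k \<bullet> r k)"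
    and p_Suc: "\<And>k. p (Suc k) = r (Suc k) + \<beta> k *\<^sub>R p k"
  shows "sqrt (T (e - v n) \<bullet> (e - v n))
    \<le> 2 * ((sqrt M - sqrt m) / (sqrt M + sqrt m)) ^ n * sqrt (T e \<bullet> e)"
proof -
  \<comment> \<open>The Krylov space is spanned by search directions rather than by powers of
    \<open>T\<close>, so that \<open>K 0\<close> is trivial and \<open>v n\<close> lies in
    \<open>K n\<close> by the update rule alone.\<close>
  define K where "K = (\<lambda>n. span (p ` {..<n}))"
  have sub: "subspace (K n)" for n by (simp add: K_def)
  have mono: "K n \<subseteq> K (Suc n)" for n unfolding K_def by (intro span_mono) auto
  have p_K: "p n \<in> K (Suc n)" for n unfolding K_def by (intro span_base) auto
  have K_SucE: "\<exists>s. w - s *\<^sub>R p n \<in> K n" if "w \<in> K (Suc n)" for w n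
    using that unfolding K_def by (simp add: lessThan_Suc span_breakdown_eq)
  have rp_V: "r n \<in> V \<and> p n \<in> V" for n
    by (induction n) (auto simp: r0 p0 r_Suc p_Suc e intro!: V_intros)
  have K_V: "K n \<subseteq> V" for n
    unfolding K_def using rp_V by (intro span_minimal subspace_V) auto
  have v_K: "v n \<in> K n" for n
  proof (induction n)
    case (Suc n)
    then show ?case unfolding v_Suc using mono p_K by (intro subspace_add subspace_scale sub) auto
  qed (simp add: v0 sub subspace_0)
  \<comment> \<open>This turns orthogonality of the residual to \<open>K n\<close> into
    orthogonality of the error in the form of \<open>T\<close>.\<close>
  have r_v: "r n = T (e - v n)" for n
    by (induction n) (simp_all add: r0 v0 r_Suc v_Suc T_diff T_add T_scaleR)
  have p0_if_r0: "p n = 0" if "r n = 0" for n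
    using that by (cases n) (simp_all add: p0 r0 p_Suc \<beta>)
  have r_K: "r n \<in> K (Suc n)" for n
  proof (cases n)
    case 0
    then show ?thesis using p_K[of 0] by (simp add: p0 r0)
  next
    case (Suc j)
    have "r n = p n - \<beta> j *\<^sub>R p j" using p_Suc[of j] Suc by simp
    then show ?thesis using Suc p_K[of n] p_K[of j] mono[of n] by (auto intro!: subspace_diff subspace_scale sub)
  qed
  have Tp_zero: "p n = 0" if "T (p n) \<bullet> p n = 0" for n
    using T_definite rp_V that by blast
  \<comment> \<open>The four claims depend on each other: conjugacy of the new direction to
    \<open>K n\<close> uses that the new residual is orthogonal to \<open>T w\<close>, which lies in
    \<open>K (Suc n)\<close>.\<close>
  have main: "(\<forall>w\<in>K n. r n \<bullet> w = 0) \<and> (\<forall>w\<in>K n. T (p n) \<bullet> w = 0) \<and> r n \<bullet> p n = r n \<bullet> r n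
      \<and> (\<forall>w\<in>K n. T w \<in> K (Suc n))" for n
  proof (induction n)
    case 0
    show ?case by (auto simp: K_def r0 p0 T_zero span_zero)
  next
    case (Suc n)
    then have r_orth: "\<And>w. w \<in> K n \<Longrightarrow> r n \<bullet> w = 0" and p_orth: "\<And>w. w \<in> K n \<Longrightarrow> T (p n) \<bullet> w = 0"
      and rp: "r n \<bullet> p n = r n \<bullet> r n" and T_K: "\<And>w. w \<in> K n \<Longrightarrow> T w \<in> K (Suc n)" by auto
    have r_eq_0: "r n = 0" if "p n = 0" using rp that by simp
    have rSp: "r (Suc n) \<bullet> p n = 0"
      using rp r_eq_0 Tp_zero[of n]
      by (cases "p n = 0") (auto simp: r_Suc inner_diff_left \<alpha> T_zero)
    have rS_orth: "r (Suc n) \<bullet> w = 0" if "w \<in> K (Suc n)" for w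
    proof -
      from K_SucE[OF that] obtain s where s: "w - s *\<^sub>R p n \<in> K n" ..
      have "r (Suc n) \<bullet> (w - s *\<^sub>R p n) = 0"
        using r_orth[OF s] p_orth[OF s] unfolding r_Suc by (simp add: inner_diff_left del: inner_diff_right)
      then show ?thesis using rSp by (simp add: inner_diff_right)
    qed
    \<comment> \<open>If \<alpha> vanishes, then so does \<open>p n\<close>, and the formula
      survives because 1 / 0 = 0.\<close>
    have Tp: "T (p n) = (1 / \<alpha> n) *\<^sub>R (r n - r (Suc n))"
    proof (cases "\<alpha> n = 0")
      case True
      then have "p n = 0" using p0_if_r0 Tp_zero by (auto simp: \<alpha>)
      then show ?thesis using True by (simp add: T_zero)
    qed (simp add: r_Suc)
    have T_KS: "T w \<in> K (Suc (Suc n))" if "w \<in> K (Suc n)" for w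
    proof -
      from K_SucE[OF that] obtain s where s: "w - s *\<^sub>R p n \<in> K n" ..
      have "T w = T (w - s *\<^sub>R p n) + s *\<^sub>R T (p n)" by (simp add: T_diff T_scaleR)
      moreover have "\<dots> \<in> K (Suc (Suc n))"
        unfolding Tp using T_K[OF s] mono r_K by (intro subspace_add subspace_diff subspace_scale sub) auto
      ultimately show ?thesis by simp
    qed
    \<comment> \<open>With \<open>T (p n)\<close> replaced by a difference of residuals, the choice
      of \<beta> cancels the two remaining terms.\<close>
    have pS_p: "T (p (Suc n)) \<bullet> p n = 0"
    proof (cases "p n = 0")
      case False
      then have "r n \<noteq> 0" "T (p n) \<bullet> p n \<noteq> 0" using p0_if_r0 Tp_zero by auto
      moreover have "r (Suc n) \<bullet> T (p n) = - (r (Suc n) \<bullet> r (Suc n)) / \<alpha> n"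
        using rS_orth[OF r_K] by (simp add: Tp inner_diff_right)
      ultimately show ?thesis
        by (simp add: p_Suc T_add T_scaleR inner_add_left T_sym[of "r (Suc n)"] \<alpha> \<beta>)
    qed simp
    have pS_orth: "T (p (Suc n)) \<bullet> w = 0" if "w \<in> K (Suc n)" for w
    proof -
      from K_SucE[OF that] obtain s where s: "w - s *\<^sub>R p n \<in> K n" ..
      have "T (p (Suc n)) \<bullet> (w - s *\<^sub>R p n) = 0"
        using p_orth[OF s] rS_orth[OF T_K[OF s]]
        by (simp add: p_Suc T_add T_scaleR inner_add_left T_sym[of "r (Suc n)"] del: inner_diff_right)
      then show ?thesis using pS_p by (simp add: inner_diff_right)
    qed
    have "r (Suc n) \<bullet> p (Suc n) = r (Suc n) \<bullet> r (Suc n)"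
      using rSp by (simp add: p_Suc inner_add_right)
    then show ?case using rS_orth pS_orth T_KS by blast
  qed
  show ?thesis
  proof (rule krylov_best_approximation[where K = K])
    show "e - v n \<in> V" using e v_K K_V by (intro V_intros) auto
    show "T e \<in> K 1" using p_K[of 0] by (simp add: p0)
    show "e - v n - e \<in> K n" using v_K sub by (simp add: subspace_neg)
    show "T (e - v n) \<bullet> w = 0" if "w \<in> K n" for w using main that by (simp add: r_v[symmetric])
  qed (use e sub mono K_V main in auto)
qed

end

subsection \<open>Square integrable functions\<close>

lemma L2_measurable: "f \<in> L2 \<Longrightarrow> f \<in> borel_measurable (lebesgue_on Omega)"
  by (simp add: L2_def)

lemma L2_integrable_square: "f \<in> L2 \<Longrightarrow> integrable (lebesgue_on Omega) (\<lambda>x. (f x)\<^sup>2)"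
  by (simp add: L2_def)

lemma L2_integrable_mult:
  assumes "f \<in> L2" "g \<in> L2"
  shows "integrable (lebesgue_on Omega) (\<lambda>x. f x * g x)"
proof (rule Bochner_Integration.integrable_bound)
  show "integrable (lebesgue_on Omega) (\<lambda>x. (f x)\<^sup>2 + (g x)\<^sup>2)"
    using assms by (simp add: L2_integrable_square)
  show "(\<lambda>x. f x * g x) \<in> borel_measurable (lebesgue_on Omega)"
    using assms[THEN L2_measurable] by measurable
  have "\<bar>s * t\<bar> \<le> s\<^sup>2 + t\<^sup>2" for s t :: real
    using sum_squares_bound[of "\<bar>s\<bar>" "\<bar>t\<bar>"] mult_nonneg_nonneg[of "\<bar>s\<bar>" "\<bar>t\<bar>"]
    by (simp add: abs_mult del: mult_nonneg_nonneg)
  then show "AE x in lebesgue_on Omega. norm (f x * g x) \<le> norm ((f x)\<^sup>2 + (g x)\<^sup>2)"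
    by simp
qed

lemma L2_add: "f \<in> L2 \<Longrightarrow> g \<in> L2 \<Longrightarrow> (\<lambda>x. f x + g x) \<in> L2"
  using L2_integrable_mult[of f g]
  by (auto simp: L2_def power2_sum mult.assoc)

lemma L2_scale: "f \<in> L2 \<Longrightarrow> (\<lambda>x. s * f x) \<in> L2"
  by (auto simp: L2_def power_mult_distrib)

lemma L2_diff: "f \<in> L2 \<Longrightarrow> g \<in> L2 \<Longrightarrow> (\<lambda>x. f x - g x) \<in> L2"
  using L2_add[of f "\<lambda>x. -1 * g x"] L2_scale[of g "-1"] by simp

lemma L2_zero: "(\<lambda>x. 0) \<in> L2"
  by (simp add: L2_def)

lemma ae_eq_refl: "ae_eq f f"
  by (simp add: ae_eq_def)

lemma ae_eq_sym: "ae_eq f g \<Longrightarrow> ae_eq g f"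
  by (simp add: ae_eq_def eq_commute)

lemma ae_eq_trans [trans]: "ae_eq f g \<Longrightarrow> ae_eq g h \<Longrightarrow> ae_eq f h"
  unfolding ae_eq_def by (elim AE_mp) auto

lemma ip_commute: "ip f g = ip g f"
  by (simp add: ip_def mult.commute)

lemma ip_cong:
  assumes "ae_eq f f'" "ae_eq g g'"
    and "f \<in> borel_measurable (lebesgue_on Omega)" "f' \<in> borel_measurable (lebesgue_on Omega)"
    and "g \<in> borel_measurable (lebesgue_on Omega)" "g' \<in> borel_measurable (lebesgue_on Omega)"
  shows "ip f g = ip f' g'"
  unfolding ip_def
proof (rule integral_cong_AE)
  show "AE x in lebesgue_on Omega. f x * g x = f' x * g' x"
    using assms(1,2) unfolding ae_eq_def by eventually_elim simp
qed (use assms in measurable)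

lemma ip_add_left: "f \<in> L2 \<Longrightarrow> g \<in> L2 \<Longrightarrow> h \<in> L2 \<Longrightarrow> ip (\<lambda>x. f x + g x) h = ip f h + ip g h"
  by (simp add: ip_def distrib_right L2_integrable_mult)

lemma ip_diff_left: "f \<in> L2 \<Longrightarrow> g \<in> L2 \<Longrightarrow> h \<in> L2 \<Longrightarrow> ip (\<lambda>x. f x - g x) h = ip f h - ip g h"
  by (simp add: ip_def left_diff_distrib L2_integrable_mult)

lemma ip_scale_left: "ip (\<lambda>x. s * f x) h = s * ip f h"
  by (simp add: ip_def mult.assoc)

lemma ip_self_nonneg: "0 \<le> ip f f"
  by (simp add: ip_def)

lemma ip_self_eq_0_iff:
  assumes "f \<in> L2"
  shows "ip f f = 0 \<longleftrightarrow> ae_eq f (\<lambda>x. 0)"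
  unfolding ip_def ae_eq_def using L2_integrable_mult[OF assms assms]
  by (subst integral_nonneg_eq_0_iff_AE) auto

lemma L2norm_square: "(L2norm f)\<^sup>2 = ip f f"
  by (simp add: L2norm_def ip_self_nonneg)

subsection \<open>The space of square integrable classes\<close>

\<comment> \<open>Null functions must be identified because \<open>real_inner\<close> demands a
  definite inner product; the partial relation leaves functions outside \<open>L2\<close> without a
  class.\<close>
quotient_type lsq = "real \<Rightarrow> real" / partial: "\<lambda>f g. f \<in> L2 \<and> g \<in> L2 \<and> ae_eq f g"
  morphisms lsq_rep lsq_of
  by (rule part_equivpI)
    (use L2_zero in \<open>auto intro!: exI[of _ "\<lambda>x. 0"] ae_eq_refl sympI transpI intro: ae_eq_sym ae_eq_trans\<close>)

instantiation lsq :: real_inner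
begin

lift_definition zero_lsq :: lsq is "\<lambda>x. 0"
  by (simp add: L2_zero ae_eq_refl)

lift_definition plus_lsq :: "lsq \<Rightarrow> lsq \<Rightarrow> lsq" is "\<lambda>f g x. f x + g x"
  by (auto simp: L2_add ae_eq_def elim!: AE_mp)

lift_definition minus_lsq :: "lsq \<Rightarrow> lsq \<Rightarrow> lsq" is "\<lambda>f g x. f x - g x"
  by (auto simp: L2_diff ae_eq_def elim!: AE_mp)

lift_definition uminus_lsq :: "lsq \<Rightarrow> lsq" is "\<lambda>f x. -1 * f x"
  by (auto simp: L2_scale[of _ "-1", simplified] ae_eq_def elim!: AE_mp)

lift_definition scaleR_lsq :: "real \<Rightarrow> lsq \<Rightarrow> lsq" is "\<lambda>s f x. s * f x"
  by (auto simp: L2_scale ae_eq_def elim!: AE_mp)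

lift_definition inner_lsq :: "lsq \<Rightarrow> lsq \<Rightarrow> real" is ip
  by (auto intro!: ip_cong L2_measurable)

definition norm_lsq :: "lsq \<Rightarrow> real" where "norm_lsq x = sqrt (x \<bullet> x)"

definition dist_lsq :: "lsq \<Rightarrow> lsq \<Rightarrow> real" where "dist_lsq x y = norm (x - y)"

definition sgn_lsq :: "lsq \<Rightarrow> lsq" where "sgn_lsq x = inverse (norm x) *\<^sub>R x"

definition uniformity_lsq :: "(lsq \<times> lsq) filter"
  where "uniformity_lsq = (INF e\<in>{0<..}. principal {(x, y). dist x y < e})"

definition open_lsq :: "lsq set \<Rightarrow> bool"
  where "open_lsq U \<longleftrightarrow> (\<forall>x\<in>U. eventually (\<lambda>(x', y). x' = x \<longrightarrow> y \<in> U) uniformity)"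

instance
proof
  fix x y z :: lsq and s t :: real
  show "dist x y = norm (x - y)" by (rule dist_lsq_def)
  show "sgn x = inverse (norm x) *\<^sub>R x" by (rule sgn_lsq_def)
  show "uniformity = (INF e\<in>{0<..}. principal {(x :: lsq, y). dist x y < e})"
    by (rule uniformity_lsq_def)
  show "open U \<longleftrightarrow> (\<forall>x\<in>U. eventually (\<lambda>(x', y). x' = x \<longrightarrow> y \<in> U) uniformity)" for U :: "lsq set"
    by (rule open_lsq_def)
  show "norm x = sqrt (x \<bullet> x)" by (rule norm_lsq_def)
  show "x + y + z = x + (y + z)"
    by transfer (auto simp: L2_add add.assoc ae_eq_refl)
  show "x + y = y + x" by transfer (auto simp: L2_add add.commute ae_eq_refl)
  show "0 + x = x" by transfer (auto simp: ae_eq_refl)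
  show "- x + x = 0" by transfer (auto simp: L2_zero ae_eq_refl)
  show "x - y = x + - y" by transfer (auto simp: L2_diff ae_eq_refl)
  show "s *\<^sub>R (x + y) = s *\<^sub>R x + s *\<^sub>R y"
    by transfer (auto simp: L2_add L2_scale distrib_left ae_eq_refl)
  show "(s + t) *\<^sub>R x = s *\<^sub>R x + t *\<^sub>R x"
    by transfer (auto simp: L2_add L2_scale distrib_right ae_eq_refl)
  show "s *\<^sub>R t *\<^sub>R x = (s * t) *\<^sub>R x"
    by transfer (auto simp: L2_scale mult.assoc ae_eq_refl)
  show "1 *\<^sub>R x = x" by transfer (auto simp: ae_eq_refl)
  show "x \<bullet> y = y \<bullet> x" by transfer (rule ip_commute)
  show "(x + y) \<bullet> z = x \<bullet> z + y \<bullet> z" by transfer (simp add: ip_add_left)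
  show "(s *\<^sub>R x) \<bullet> y = s * (x \<bullet> y)" by transfer (simp add: ip_scale_left)
  show "0 \<le> x \<bullet> x" by transfer (rule ip_self_nonneg)
  show "x \<bullet> x = 0 \<longleftrightarrow> x = 0" by transfer (simp add: ip_self_eq_0_iff L2_zero)
qed

end

lemma lsq_rep_L2: "lsq_rep x \<in> L2"
  using Quotient3_rep_reflp[OF Quotient3_lsq, of x] by simp

lemma lsq_of_rep: "lsq_of (lsq_rep x) = x"
  by (rule Quotient3_abs_rep[OF Quotient3_lsq])

lemma lsq_of_eq_iff: "f \<in> L2 \<Longrightarrow> g \<in> L2 \<Longrightarrow> lsq_of f = lsq_of g \<longleftrightarrow> ae_eq f g"
  using Quotient3_rel[OF Quotient3_lsq, of f g] by (auto simp: ae_eq_refl)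

lemma lsq_of_zero: "lsq_of (\<lambda>x. 0) = 0"
  by (simp add: zero_lsq.abs_eq)

lemma lsq_of_add: "f \<in> L2 \<Longrightarrow> g \<in> L2 \<Longrightarrow> lsq_of (\<lambda>x. f x + g x) = lsq_of f + lsq_of g"
  by (simp add: plus_lsq.abs_eq ae_eq_refl)

lemma lsq_of_diff: "f \<in> L2 \<Longrightarrow> g \<in> L2 \<Longrightarrow> lsq_of (\<lambda>x. f x - g x) = lsq_of f - lsq_of g"
  by (simp add: minus_lsq.abs_eq ae_eq_refl)

lemma lsq_of_scale: "f \<in> L2 \<Longrightarrow> lsq_of (\<lambda>x. s * f x) = s *\<^sub>R lsq_of f"
  by (simp add: scaleR_lsq.abs_eq ae_eq_refl)

lemma inner_lsq_of: "f \<in> L2 \<Longrightarrow> g \<in> L2 \<Longrightarrow> lsq_of f \<bullet> lsq_of g = ip f g"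
  by (simp add: inner_lsq.abs_eq ae_eq_refl)

text \<open>The defect of linearity is orthogonal to every vector, in particular to itself.\<close>

lemma linear_if_symmetric:
  fixes A :: "'a::real_inner \<Rightarrow> 'a"
  assumes "\<And>x y. A x \<bullet> y = x \<bullet> A y"
  shows "linear A"
proof (rule linearI)
  fix x y :: 'a and s :: real
  have "(A (x + y) - (A x + A y)) \<bullet> z = 0" for z
    by (simp add: inner_diff_left inner_add_left assms)
  from this[of "A (x + y) - (A x + A y)"] show "A (x + y) = A x + A y" by simp
  have "(A (s *\<^sub>R x) - s *\<^sub>R A x) \<bullet> z = 0" for z
    by (simp add: inner_diff_left assms)
  from this[of "A (s *\<^sub>R x) - s *\<^sub>R A x"] show "A (s *\<^sub>R x) = s *\<^sub>R A x" by simp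
qed

section \<open>Weak derivatives and almost everywhere equality\<close>

lemma wderiv_H1:
  assumes "f \<in> H1"
  shows "wderiv f \<in> L2"
proof -
  have "\<exists>g. g \<in> L2 \<and> has_weak_deriv f g" using assms by (auto simp: H1_def)
  then show ?thesis unfolding wderiv_def by (rule someI2_ex) simp
qed

lemma test_function_continuous:
  assumes "\<eta> \<in> test_functions"
  shows "continuous_on UNIV ((deriv ^^ n) \<eta>)"
  using assms unfolding test_functions_def
  by (auto intro!: continuous_at_imp_continuous_on field_differentiable_imp_continuous_at)

lemma test_function_measurable:
  assumes "\<eta> \<in> test_functions"
  shows "\<eta> \<in> borel_measurable (lebesgue_on Omega)" "deriv \<eta> \<in> borel_measurable (lebesgue_on Omega)"
  using test_function_continuous[OF assms, of 0] test_function_continuous[OF assms, of 1]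
  by (auto intro!: continuous_imp_measurable_on_sets_lebesgue intro: continuous_on_subset)

lemma has_weak_deriv_cong:
  assumes "ae_eq f g"
    and "f \<in> borel_measurable (lebesgue_on Omega)" "g \<in> borel_measurable (lebesgue_on Omega)"
  shows "has_weak_deriv f = has_weak_deriv g"
proof -
  have "ip f (deriv \<eta>) = ip g (deriv \<eta>)" if "\<eta> \<in> test_functions" for \<eta>
    using assms test_function_measurable[OF that] by (intro ip_cong ae_eq_refl)
  then show ?thesis by (auto simp: has_weak_deriv_def fun_eq_iff)
qed

text \<open>The two functions have the same predicate of weak derivatives, so \<open>SOME\<close>
  picks literally the same function for both, not merely an equivalent one.\<close>

lemma wderiv_cong:
  assumes "ae_eq f g"
    and "f \<in> borel_measurable (lebesgue_on Omega)" "g \<in> borel_measurable (lebesgue_on Omega)"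
  shows "wderiv f = wderiv g"
  unfolding wderiv_def has_weak_deriv_cong[OF assms] ..

lemma H1_cong: "ae_eq f g \<Longrightarrow> f \<in> H1 \<Longrightarrow> g \<in> L2 \<Longrightarrow> g \<in> H1"
  using has_weak_deriv_cong[of f g] by (auto simp: H1_def L2_measurable)

lemma H10_cong:
  assumes fg: "ae_eq f g" and f: "f \<in> H10" and g: "g \<in> L2"
  shows "g \<in> H10"
proof -
  have f_L2: "f \<in> L2" and f_H1: "f \<in> H1" using f by (auto simp: H10_def H1_def)
  have "H1norm (\<lambda>x. f x - \<eta> x) = H1norm (\<lambda>x. g x - \<eta> x)" if "\<eta> \<in> test_functions" for \<eta>
  proof -
    have ae: "ae_eq (\<lambda>x. f x - \<eta> x) (\<lambda>x. g x - \<eta> x)"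
      using fg by (auto simp: ae_eq_def)
    have meas: "(\<lambda>x. f x - \<eta> x) \<in> borel_measurable (lebesgue_on Omega)"
      "(\<lambda>x. g x - \<eta> x) \<in> borel_measurable (lebesgue_on Omega)"
      using f_L2 g test_function_measurable[OF that] by (auto intro!: borel_measurable_diff dest: L2_measurable)
    show ?thesis
      unfolding H1norm_def L2norm_def wderiv_cong[OF ae meas] ip_cong[OF ae ae meas meas] ..
  qed
  then show ?thesis using f H1_cong[OF fg f_H1 g] by (auto simp: H10_def)
qed

section \<open>The bilinear form: invariance, upper bound, definiteness\<close>

lemma bform_commute: "bform a c f g = bform a c g f"
  by (simp add: bform_def mult_ac)

lemma bform_cong:
  assumes coeff: "a \<in> Linf" "c \<in> Linf"
    and ae: "ae_eq f f'" "ae_eq g g'"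
    and H1: "f \<in> H1" "g \<in> H1" and L2: "f' \<in> L2" "g' \<in> L2"
  shows "bform a c f g = bform a c f' g'"
proof -
  have L2': "f \<in> L2" "g \<in> L2" using H1 by (auto simp: H1_def)
  have wd: "wderiv f' = wderiv f" "wderiv g' = wderiv g"
    using wderiv_cong[OF ae(1)] wderiv_cong[OF ae(2)] L2 L2' by (simp_all add: L2_measurable)
  have meas: "a \<in> borel_measurable (lebesgue_on Omega)" "c \<in> borel_measurable (lebesgue_on Omega)"
    using coeff by (auto simp: Linf_def)
  note meas = meas L2[THEN L2_measurable] L2'[THEN L2_measurable] H1[THEN wderiv_H1, THEN L2_measurable]
  show ?thesis
    unfolding bform_def wd
  proof (rule integral_cong_AE)
    show "AE x in lebesgue_on Omega. a x * wderiv f x * wderiv g x + c x * f x * g x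
        = a x * wderiv f x * wderiv g x + c x * f' x * g' x"
      using ae unfolding ae_eq_def by eventually_elim simp
  qed (use meas in measurable)
qed

lemma bform_self_nonneg:
  assumes "AE x in lebesgue_on Omega. a x > 0" "AE x in lebesgue_on Omega. c x \<ge> 0"
  shows "0 \<le> bform a c h h"
  unfolding bform_def
  by (rule integral_nonneg_AE, use assms in eventually_elim) (simp add: mult.assoc)

lemma Linf_mult_square_integrable:
  assumes "a \<in> Linf" "f \<in> L2"
  shows "integrable (lebesgue_on Omega) (\<lambda>x. a x * f x * f x)"
proof -
  obtain A where A: "AE x in lebesgue_on Omega. \<bar>a x\<bar> \<le> A"
    and meas: "a \<in> borel_measurable (lebesgue_on Omega)"
    using assms(1) by (auto simp: Linf_def)
  show ?thesis
  proof (rule Bochner_Integration.integrable_bound)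
    show "integrable (lebesgue_on Omega) (\<lambda>x. A * (f x)\<^sup>2)"
      using assms(2) by (simp add: L2_integrable_square)
    show "(\<lambda>x. a x * f x * f x) \<in> borel_measurable (lebesgue_on Omega)"
      using meas assms(2)[THEN L2_measurable] by measurable
    show "AE x in lebesgue_on Omega. norm (a x * f x * f x) \<le> norm (A * (f x)\<^sup>2)"
      using A
    proof eventually_elim
      case (elim x)
      then have "\<bar>a x\<bar> * (f x)\<^sup>2 \<le> \<bar>A\<bar> * (f x)\<^sup>2" by (intro mult_right_mono) auto
      then show ?case by (simp add: abs_mult power2_eq_square)
    qed
  qed
qed

text \<open>Two constants are kept apart because the derivative of \<open>R \<phi>\<close> is
  controlled by the Laplacian bound and \<open>R \<phi>\<close> itself by boundedness of
  \<open>R\<close>.\<close>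

lemma bform_self_le:
  assumes "a \<in> Linf" "c \<in> Linf"
  obtains A C where "0 \<le> A" "0 \<le> C"
    "\<And>h. h \<in> H1 \<Longrightarrow> bform a c h h \<le> A * (L2norm (wderiv h))\<^sup>2 + C * (L2norm h)\<^sup>2"
proof -
  obtain A where A: "AE x in lebesgue_on Omega. \<bar>a x\<bar> \<le> A" using assms(1) by (auto simp: Linf_def)
  obtain C where C: "AE x in lebesgue_on Omega. \<bar>c x\<bar> \<le> C" using assms(2) by (auto simp: Linf_def)
  have "bform a c h h \<le> \<bar>A\<bar> * (L2norm (wderiv h))\<^sup>2 + \<bar>C\<bar> * (L2norm h)\<^sup>2" if h: "h \<in> H1" for h
  proof -
    have L2: "h \<in> L2" "wderiv h \<in> L2" using h wderiv_H1 by (auto simp: H1_def)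
    have "bform a c h h
        \<le> (LINT x|lebesgue_on Omega. \<bar>A\<bar> * (wderiv h x * wderiv h x) + \<bar>C\<bar> * (h x * h x))"
      unfolding bform_def
    proof (rule integral_mono_AE)
      show "AE x in lebesgue_on Omega. a x * wderiv h x * wderiv h x + c x * h x * h x
          \<le> \<bar>A\<bar> * (wderiv h x * wderiv h x) + \<bar>C\<bar> * (h x * h x)"
        using A C
      proof eventually_elim
        case (elim x)
        then have "a x \<le> \<bar>A\<bar>" "c x \<le> \<bar>C\<bar>" by auto
        then show ?case
          unfolding mult.assoc by (intro add_mono mult_right_mono) auto
      qed
    qed (use L2 assms in \<open>simp_all add: Linf_mult_square_integrable L2_integrable_mult\<close>)
    then show ?thesis
      using L2 by (simp add: L2norm_square ip_def L2_integrable_mult)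
  qed
  then show ?thesis by (intro that[of "\<bar>A\<bar>" "\<bar>C\<bar>"]) auto
qed

text \<open>Definiteness replaces coercivity here: the integrand is a sum of nonnegative terms, and
  \<open>a\<close> is positive almost everywhere.\<close>

lemma bform_self_eq_0D:
  assumes coeff: "a \<in> Linf" "c \<in> Linf"
    and pos: "AE x in lebesgue_on Omega. a x > 0" "AE x in lebesgue_on Omega. c x \<ge> 0"
    and h: "h \<in> H1" and zero: "bform a c h h = 0"
  shows "L2norm (wderiv h) = 0"
proof -
  have L2: "h \<in> L2" "wderiv h \<in> L2" using h wderiv_H1 by (auto simp: H1_def)
  have "AE x in lebesgue_on Omega. a x * wderiv h x * wderiv h x + c x * h x * h x = 0"
  \<comment> \<open>Integrability of the integrand matters, since the integral of a non-integrable
    function is 0 by convention.\<close>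
  proof (subst integral_nonneg_eq_0_iff_AE[symmetric])
    show "AE x in lebesgue_on Omega. 0 \<le> a x * wderiv h x * wderiv h x + c x * h x * h x"
      using pos by eventually_elim (simp add: mult.assoc)
  qed (use L2 coeff zero in \<open>simp_all add: Linf_mult_square_integrable bform_def\<close>)
  then have "AE x in lebesgue_on Omega. wderiv h x = 0"
    using pos
  proof eventually_elim
    case (elim x)
    then have "0 \<le> a x * (wderiv h x * wderiv h x)" "0 \<le> c x * (h x * h x)" by auto
    then show ?case using elim by (simp add: mult.assoc add_nonneg_eq_0_iff)
  qed
  then have "ip (wderiv h) (wderiv h) = 0"
    using L2 by (simp add: ip_self_eq_0_iff ae_eq_def)
  then show ?thesis by (simp add: L2norm_def)
qed

subsection \<open>The preconditioned operator on \<open>W\<^sub>0\<close>\<close>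

lemma H1_L2: "f \<in> H1 \<Longrightarrow> f \<in> L2"
  by (simp add: H1_def)

lemma H10_H1: "f \<in> H10 \<Longrightarrow> f \<in> H1"
  by (simp add: H10_def)

lemma W0_L2: "\<phi> \<in> W0 R \<Longrightarrow> \<phi> \<in> L2"
  by (simp add: W0_def)

lemma lsq_eqI: "(\<And>g. g \<in> L2 \<Longrightarrow> x \<bullet> lsq_of g = y \<bullet> lsq_of g) \<Longrightarrow> x = y"
  by (metis inner_eq_zero_iff inner_diff_left lsq_of_rep lsq_rep_L2 right_minus_eq)

locale preconditioned_problem =
  fixes a c :: "real \<Rightarrow> real" and R Rs P T :: "(real \<Rightarrow> real) \<Rightarrow> real \<Rightarrow> real"
  assumes a_Linf: "a \<in> Linf" and a_pos: "AE x in lebesgue_on Omega. a x > 0"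
    and c_Linf: "c \<in> Linf" and c_nonneg: "AE x in lebesgue_on Omega. c x \<ge> 0"
    and R_linear: "linear_op R"
    and R_adjoint: "is_adjoint R Rs"
    and R_bounded: "bounded_op R"
    and R_smoother: "smoother R Rs"
    and R_laplacian: "laplacian_preconditioner R"
    and P_proj: "is_orth_proj (W0 R) P"
    and T_op: "is_precond_op a c R P T"
begin

lemma R_H1: "\<phi> \<in> L2 \<Longrightarrow> R \<phi> \<in> H1"
  using R_smoother by (auto simp: smoother_def)

lemma R_cong: "\<phi> \<in> L2 \<Longrightarrow> \<psi> \<in> L2 \<Longrightarrow> ae_eq \<phi> \<psi> \<Longrightarrow> ae_eq (R \<phi>) (R \<psi>)"
  using R_linear by (simp add: linear_op_def)

lemma W0_cong:
  assumes "ae_eq \<phi> \<psi>" "\<phi> \<in> W0 R" "\<psi> \<in> L2"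
  shows "\<psi> \<in> W0 R"
proof -
  have "ae_eq (R \<phi>) (R \<psi>)" using assms by (intro R_cong) (auto simp: W0_def)
  from H10_cong[OF this] show ?thesis using assms by (auto simp: W0_def H1_L2 R_H1)
qed

lemma bform_R_cong:
  assumes "ae_eq \<phi> \<phi>'" "ae_eq \<psi> \<psi>'" "\<phi> \<in> L2" "\<phi>' \<in> L2" "\<psi> \<in> L2" "\<psi>' \<in> L2"
  shows "bform a c (R \<phi>) (R \<psi>) = bform a c (R \<phi>') (R \<psi>')"
  using assms by (intro bform_cong a_Linf c_Linf R_cong R_H1 H1_L2[OF R_H1])

lemma P_W0: "\<phi> \<in> L2 \<Longrightarrow> P \<phi> \<in> W0 R"
  using P_proj by (simp add: is_orth_proj_def)

lemmas P_L2 = W0_L2[OF P_W0]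

lemma ip_P_left: "\<phi> \<in> L2 \<Longrightarrow> \<psi> \<in> W0 R \<Longrightarrow> ip (P \<phi>) \<psi> = ip \<phi> \<psi>"
  using P_proj by (simp add: is_orth_proj_def ip_diff_left P_L2 W0_L2)

lemma P_symmetric: "\<phi> \<in> L2 \<Longrightarrow> \<psi> \<in> L2 \<Longrightarrow> ip (P \<phi>) \<psi> = ip \<phi> (P \<psi>)"
  using ip_P_left[of \<phi> "P \<psi>"] ip_P_left[of \<psi> "P \<phi>"] by (simp add: P_W0 ip_commute)

lemma P_idem:
  assumes "\<phi> \<in> W0 R"
  shows "ae_eq (P \<phi>) \<phi>"
proof -
  have L2: "\<phi> \<in> L2" "P \<phi> \<in> L2" using assms by (simp_all add: W0_L2 P_L2)
  have "(lsq_of (P \<phi>) - lsq_of \<phi>) \<bullet> (lsq_of (P \<phi>) - lsq_of \<phi>) = 0"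
    using ip_P_left[OF L2(1) assms] ip_P_left[OF L2(1) P_W0[OF L2(1)]] L2
    by (simp add: inner_diff_left inner_diff_right inner_lsq_of ip_commute[of \<phi> "P \<phi>"])
  then show ?thesis using L2 by (simp add: lsq_of_eq_iff)
qed

lemma T_L2: "\<phi> \<in> L2 \<Longrightarrow> T \<phi> \<in> L2"
  using T_op by (simp add: is_precond_op_def)

lemma ip_T: "\<phi> \<in> L2 \<Longrightarrow> \<psi> \<in> L2 \<Longrightarrow> ip (T \<phi>) \<psi> = bform a c (R (P \<phi>)) (R (P \<psi>))"
  using T_op by (simp add: is_precond_op_def)

lemma T_symmetric: "\<phi> \<in> L2 \<Longrightarrow> \<psi> \<in> L2 \<Longrightarrow> ip (T \<phi>) \<psi> = ip \<phi> (T \<psi>)"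
  using ip_T[of \<phi> \<psi>] ip_T[of \<psi> \<phi>] by (simp add: bform_commute ip_commute)

lemma ip_T_W0:
  assumes "\<phi> \<in> W0 R" "\<psi> \<in> W0 R"
  shows "ip (T \<phi>) \<psi> = bform a c (R \<phi>) (R \<psi>)"
proof -
  have "\<phi> \<in> L2" "\<psi> \<in> L2" using assms by (simp_all add: W0_L2)
  then show ?thesis
    using assms by (simp add: ip_T) (intro bform_R_cong P_idem P_L2)
qed

text \<open>The weak form of \<open>T\<close> already projects its second argument, and projecting
  twice changes nothing. This is what places the range of \<open>T\<close> in
  \<open>W0\<close>.\<close>

lemma ip_T_P:
  assumes "\<phi> \<in> L2" "\<psi> \<in> L2"
  shows "ip (T \<phi>) (P \<psi>) = ip (T \<phi>) \<psi>"
  using assms by (simp add: ip_T P_L2) (intro bform_R_cong P_idem ae_eq_refl P_L2 P_W0)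

section \<open>Passage from representatives to classes\<close>

definition proj_lsq :: "lsq \<Rightarrow> lsq" where
  "proj_lsq x = lsq_of (P (lsq_rep x))"

definition op_lsq :: "lsq \<Rightarrow> lsq" where
  "op_lsq x = lsq_of (T (lsq_rep x))"

definition W :: "lsq set" where
  "W = lsq_of ` W0 R"

lemma proj_lsq_symmetric: "proj_lsq x \<bullet> y = x \<bullet> proj_lsq y"
proof -
  have "lsq_of (P (lsq_rep x)) \<bullet> lsq_of (lsq_rep y) = lsq_of (lsq_rep x) \<bullet> lsq_of (P (lsq_rep y))"
    by (simp add: inner_lsq_of lsq_rep_L2 P_L2 P_symmetric)
  then show ?thesis by (simp add: proj_lsq_def lsq_of_rep)
qed

lemma op_lsq_symmetric: "op_lsq x \<bullet> y = x \<bullet> op_lsq y"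
proof -
  have "lsq_of (T (lsq_rep x)) \<bullet> lsq_of (lsq_rep y) = lsq_of (lsq_rep x) \<bullet> lsq_of (T (lsq_rep y))"
    by (simp add: inner_lsq_of lsq_rep_L2 T_L2 T_symmetric)
  then show ?thesis by (simp add: op_lsq_def lsq_of_rep)
qed

text \<open>Respect for null sets is not part of \<open>is_orth_proj\<close>. Symmetry moves the
  projection to the other factor, where the original argument enters only through an inner product;
  the same argument serves \<open>T\<close> below.\<close>

lemma proj_lsq_of:
  assumes "\<phi> \<in> L2"
  shows "proj_lsq (lsq_of \<phi>) = lsq_of (P \<phi>)"
proof (rule lsq_eqI)
  fix \<psi> assume \<psi>: "\<psi> \<in> L2"
  have "proj_lsq (lsq_of \<phi>) \<bullet> lsq_of \<psi> = lsq_of \<phi> \<bullet> proj_lsq (lsq_of \<psi>)"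
    by (rule proj_lsq_symmetric)
  also have "\<dots> = ip (P \<phi>) (lsq_rep (lsq_of \<psi>))"
    using assms by (simp add: proj_lsq_def inner_lsq_of P_L2 lsq_rep_L2 P_symmetric)
  also have "\<dots> = lsq_of (P \<phi>) \<bullet> lsq_of \<psi>"
    using assms inner_lsq_of[of "P \<phi>" "lsq_rep (lsq_of \<psi>)"] by (simp add: P_L2 lsq_rep_L2 lsq_of_rep)
  finally show "proj_lsq (lsq_of \<phi>) \<bullet> lsq_of \<psi> = lsq_of (P \<phi>) \<bullet> lsq_of \<psi>" .
qed

lemma op_lsq_of:
  assumes "\<phi> \<in> L2"
  shows "op_lsq (lsq_of \<phi>) = lsq_of (T \<phi>)"
proof (rule lsq_eqI)
  fix \<psi> assume \<psi>: "\<psi> \<in> L2"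
  have "op_lsq (lsq_of \<phi>) \<bullet> lsq_of \<psi> = lsq_of \<phi> \<bullet> op_lsq (lsq_of \<psi>)"
    by (rule op_lsq_symmetric)
  also have "\<dots> = ip (T \<phi>) (lsq_rep (lsq_of \<psi>))"
    using assms by (simp add: op_lsq_def inner_lsq_of T_L2 lsq_rep_L2 T_symmetric)
  also have "\<dots> = lsq_of (T \<phi>) \<bullet> lsq_of \<psi>"
    using assms inner_lsq_of[of "T \<phi>" "lsq_rep (lsq_of \<psi>)"] by (simp add: T_L2 lsq_rep_L2 lsq_of_rep)
  finally show "op_lsq (lsq_of \<phi>) \<bullet> lsq_of \<psi> = lsq_of (T \<phi>) \<bullet> lsq_of \<psi>" .
qed

lemma lsq_of_in_W_iff: "\<phi> \<in> L2 \<Longrightarrow> lsq_of \<phi> \<in> W \<longleftrightarrow> \<phi> \<in> W0 R"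
  unfolding W_def by (auto simp: lsq_of_eq_iff W0_L2) (blast intro: W0_cong ae_eq_sym)

text \<open>This makes \<open>W\<close> a subspace by linearity of the projection; uniqueness and linearity of weak
  derivatives are then never needed.\<close>

lemma in_W_iff: "x \<in> W \<longleftrightarrow> proj_lsq x = x"
proof -
  have "\<phi> \<in> W0 R \<longleftrightarrow> proj_lsq (lsq_of \<phi>) = lsq_of \<phi>" if "\<phi> \<in> L2" for \<phi>
    using that P_idem[of \<phi>] W0_cong[OF _ P_W0, of \<phi> \<phi>]
    by (auto simp: proj_lsq_of lsq_of_eq_iff P_L2)
  from this[of "lsq_rep x"] show ?thesis
    using lsq_of_in_W_iff[of "lsq_rep x"] by (simp add: lsq_rep_L2 lsq_of_rep)
qed

lemma subspace_W: "subspace W"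
proof -
  have lin: "linear proj_lsq" by (rule linear_if_symmetric) (rule proj_lsq_symmetric)
  show ?thesis
    by (rule subspaceI) (simp_all add: in_W_iff linear_0[OF lin] linear_add[OF lin] linear_scale[OF lin])
qed

lemma op_lsq_in_W: "op_lsq x \<in> W"
proof -
  have "proj_lsq (op_lsq x) = op_lsq x"
  proof (rule lsq_eqI)
    fix \<psi> assume \<psi>: "\<psi> \<in> L2"
    have "proj_lsq (op_lsq x) \<bullet> lsq_of \<psi> = op_lsq x \<bullet> lsq_of (P \<psi>)"
      using \<psi> by (simp add: proj_lsq_symmetric proj_lsq_of)
    also have "\<dots> = op_lsq x \<bullet> lsq_of \<psi>"
      using \<psi> by (simp add: op_lsq_def inner_lsq_of T_L2 P_L2 lsq_rep_L2 ip_T_P)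
    finally show "proj_lsq (op_lsq x) \<bullet> lsq_of \<psi> = op_lsq x \<bullet> lsq_of \<psi>" .
  qed
  then show ?thesis by (simp add: in_W_iff)
qed

section \<open>Spectral bounds and the condition number\<close>

lemma inner_op_lsq:
  assumes "\<phi> \<in> W0 R" "\<psi> \<in> W0 R"
  shows "op_lsq (lsq_of \<phi>) \<bullet> lsq_of \<psi> = bform a c (R \<phi>) (R \<psi>)"
  using assms by (simp add: op_lsq_of inner_lsq_of T_L2 W0_L2 ip_T_W0)

text \<open>A zero of the form has vanishing (R \<phi>)', and the lower Laplacian bound then removes
  \<phi> itself.\<close>

lemma bform_R_eq_0D:
  assumes "\<phi> \<in> L2" "bform a c (R \<phi>) (R \<phi>) = 0"
  shows "ip \<phi> \<phi> = 0"
proof -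
  obtain \<gamma> where \<gamma>: "0 < \<gamma>" "\<gamma> * (L2norm \<phi>)\<^sup>2 \<le> (L2norm (wderiv (R \<phi>)))\<^sup>2"
    using R_laplacian assms(1) by (auto simp: laplacian_preconditioner_def)
  have "L2norm (wderiv (R \<phi>)) = 0"
    using bform_self_eq_0D[OF a_Linf c_Linf a_pos c_nonneg R_H1] assms by blast
  then have "\<gamma> * ip \<phi> \<phi> \<le> 0" using \<gamma>(2) by (simp add: L2norm_square)
  then show ?thesis using \<gamma>(1) ip_self_nonneg[of \<phi>] by (simp add: mult_le_0_iff)
qed

text \<open>This makes the numerator of the condition number finite.\<close>

lemma bform_R_bounded:
  obtains C where "\<And>\<phi>. \<phi> \<in> L2 \<Longrightarrow> L2norm \<phi> = 1 \<Longrightarrow> bform a c (R \<phi>) (R \<phi>) \<le> C"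
proof -
  obtain A B where AB: "0 \<le> A" "0 \<le> B"
    "\<And>h. h \<in> H1 \<Longrightarrow> bform a c h h \<le> A * (L2norm (wderiv h))\<^sup>2 + B * (L2norm h)\<^sup>2"
    using bform_self_le[OF a_Linf c_Linf] by blast
  obtain \<gamma> where \<gamma>: "\<And>\<phi>. \<phi> \<in> L2 \<Longrightarrow> (L2norm (wderiv (R \<phi>)))\<^sup>2 \<le> \<gamma> * (L2norm \<phi>)\<^sup>2"
    using R_laplacian by (auto simp: laplacian_preconditioner_def)
  obtain N where N: "\<And>\<phi>. \<phi> \<in> L2 \<Longrightarrow> L2norm \<phi> = 1 \<Longrightarrow> L2norm (R \<phi>) \<le> N"
    using R_bounded by (auto simp: bounded_op_def bdd_above_def)
  have "bform a c (R \<phi>) (R \<phi>) \<le> A * \<gamma> + B * N\<^sup>2" if "\<phi> \<in> L2" "L2norm \<phi> = 1" for \<phi>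
  proof -
    have "(L2norm (R \<phi>))\<^sup>2 \<le> N\<^sup>2"
      using N[OF that] by (intro power_mono) (auto simp: L2norm_def ip_self_nonneg)
    moreover have "(L2norm (wderiv (R \<phi>)))\<^sup>2 \<le> \<gamma>" using \<gamma>[of \<phi>] that by simp
    ultimately have "A * (L2norm (wderiv (R \<phi>)))\<^sup>2 + B * (L2norm (R \<phi>))\<^sup>2 \<le> A * \<gamma> + B * N\<^sup>2"
      using AB(1,2) by (intro add_mono mult_left_mono)
    then show ?thesis using AB(3)[OF R_H1[OF that(1)]] by linarith
  qed
  then show ?thesis using that by blast
qed

lemma spectral_bounds_from_unit_sphere:
  assumes unit: "\<phi>\<^sub>0 \<in> W0 R" "L2norm \<phi>\<^sub>0 = 1"
    and bounds: "\<And>\<phi>. \<phi> \<in> W0 R \<Longrightarrow> L2norm \<phi> = 1 \<Longrightarrow>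
      m \<le> bform a c (R \<phi>) (R \<phi>) \<and> bform a c (R \<phi>) (R \<phi>) \<le> M"
    and m: "0 \<le> m"
  shows "spectral_bounds op_lsq W m M"
proof -
  have op_bounds: "m * (x \<bullet> x) \<le> op_lsq x \<bullet> x \<and> op_lsq x \<bullet> x \<le> M * (x \<bullet> x)" if x: "x \<in> W" for x
  proof (cases "x = 0")
    case False
    define z where "z = x /\<^sub>R norm x"
    have lin: "linear op_lsq" by (rule linear_if_symmetric) (rule op_lsq_symmetric)
    have "z \<in> W" using x subspace_W unfolding z_def by (rule subspace_scale[rotated])
    then obtain \<phi> where \<phi>: "\<phi> \<in> W0 R" "z = lsq_of \<phi>" by (auto simp: W_def)
    have "norm z = 1" using False by (simp add: z_def)
    then have "L2norm \<phi> = 1"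
      using \<phi> by (simp add: L2norm_def norm_eq_sqrt_inner inner_lsq_of W0_L2)
    from bounds[OF \<phi>(1) this] have b: "m \<le> op_lsq z \<bullet> z" "op_lsq z \<bullet> z \<le> M"
      using inner_op_lsq[OF \<phi>(1) \<phi>(1)] \<phi>(2) by simp_all
    have "x = norm x *\<^sub>R z" using False by (simp add: z_def)
    then have "op_lsq x \<bullet> x = (op_lsq z \<bullet> z) * (norm x)\<^sup>2"
      by (metis inner_scaleR_left inner_scaleR_right linear_scale[OF lin] mult.assoc mult.commute power2_eq_square)
    then show ?thesis
      using b by (simp add: power2_norm_eq_inner[symmetric] mult_right_mono)
  qed (simp add: linear_0[OF linear_if_symmetric[OF op_lsq_symmetric]])
  have definite: "x = 0" if x: "x \<in> W" "op_lsq x \<bullet> x = 0" for x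
  proof -
    obtain \<phi> where \<phi>: "\<phi> \<in> W0 R" "x = lsq_of \<phi>" using x(1) by (auto simp: W_def)
    then have "ip \<phi> \<phi> = 0" using x(2) bform_R_eq_0D[of \<phi>] by (simp add: inner_op_lsq W0_L2)
    then have "x \<bullet> x = 0" using \<phi> by (simp add: inner_lsq_of W0_L2)
    then show ?thesis by simp
  qed
  \<comment> \<open>The unit vector is there to make \<open>M\<close> strictly positive.\<close>
  have "bform a c (R \<phi>\<^sub>0) (R \<phi>\<^sub>0) \<noteq> 0"
    using bform_R_eq_0D[of \<phi>\<^sub>0] unit by (auto simp: L2norm_def W0_L2)
  then have "0 < M"
    using bounds[OF unit] bform_self_nonneg[OF a_pos c_nonneg, of "R \<phi>\<^sub>0"] by linarith
  then show ?thesis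
    using op_bounds definite m
    by (intro spectral_bounds.intro linear_if_symmetric op_lsq_symmetric subspace_W op_lsq_in_W) auto
qed

lemma cg_factor_restricted_cond:
  assumes unit: "\<phi>\<^sub>0 \<in> W0 R" "L2norm \<phi>\<^sub>0 = 1"
  obtains m M where "spectral_bounds op_lsq W m M"
    "cg_factor (restricted_cond a c R) = (sqrt M - sqrt m) / (sqrt M + sqrt m)"
proof -
  define U where "U = {\<phi> \<in> W0 R. L2norm \<phi> = 1}"
  define q where "q = (\<lambda>\<phi>. ereal (bform a c (R \<phi>) (R \<phi>)))"
  have q_nonneg: "0 \<le> q \<phi>" for \<phi>
    using bform_self_nonneg[OF a_pos c_nonneg] by (simp add: q_def)
  obtain C where C: "\<And>\<phi>. \<phi> \<in> L2 \<Longrightarrow> L2norm \<phi> = 1 \<Longrightarrow> bform a c (R \<phi>) (R \<phi>) \<le> C"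
    using bform_R_bounded by blast
  have U: "\<phi>\<^sub>0 \<in> U" using unit by (simp add: U_def)
  have sup: "(SUP \<phi>\<in>U. q \<phi>) \<le> ereal C"
    by (rule SUP_least) (auto simp: U_def q_def W0_L2 C)
  have "0 \<le> (SUP \<phi>\<in>U. q \<phi>)" using SUP_upper2[OF U q_nonneg] .
  with sup obtain M where M: "(SUP \<phi>\<in>U. q \<phi>) = ereal M" by (cases "SUP \<phi>\<in>U. q \<phi>") auto
  have inf: "0 \<le> (INF \<phi>\<in>U. q \<phi>)" by (rule INF_greatest) (rule q_nonneg)
  have "(INF \<phi>\<in>U. q \<phi>) \<le> ereal M" 
    using order_trans[OF INF_lower[OF U, of q] SUP_upper[OF U, of q]] by (simp only: M)
  with inf obtain m where m: "(INF \<phi>\<in>U. q \<phi>) = ereal m" by (cases "INF \<phi>\<in>U. q \<phi>") auto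
  have m_nonneg: "0 \<le> m" using inf m by simp
  have "m \<le> bform a c (R \<phi>) (R \<phi>) \<and> bform a c (R \<phi>) (R \<phi>) \<le> M" if "\<phi> \<in> U" for \<phi>
    using INF_lower[OF that, of q] SUP_upper[OF that, of q] m M by (simp add: q_def)
  then have sb: "spectral_bounds op_lsq W m M"
    by (intro spectral_bounds_from_unit_sphere[OF unit] m_nonneg) (auto simp: U_def)
  have M_pos: "0 < M" using sb by (rule spectral_bounds.M_pos)
  have \<kappa>: "restricted_cond a c R = ereal M / ereal m"
    unfolding restricted_cond_def M[symmetric] m[symmetric] by (simp add: U_def q_def)
  have "cg_factor (restricted_cond a c R) = (sqrt M - sqrt m) / (sqrt M + sqrt m)"
  \<comment> \<open>For m = 0 the quotient of extended reals is infinite because M > 0, and the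
    value 1 of \<open>cg_factor\<close> agrees with sqrt M / sqrt M.\<close>
  proof (cases "m = 0")
    case True
    then show ?thesis using M_pos by (simp add: \<kappa> cg_factor_def)
  next
    case False
    then have "0 < m" using m_nonneg by simp
    moreover have "(s / t - 1) / (s / t + 1) = (s - t) / (s + t)" if "0 < t" for s t :: real
    proof -
      have "s / t - 1 = (s - t) / t" "s / t + 1 = (s + t) / t" using that by (simp_all add: field_simps)
      then show ?thesis using that by simp
    qed
    ultimately show ?thesis by (simp add: \<kappa> cg_factor_def real_sqrt_divide)
  qed
  with sb show ?thesis by (rule that)
qed

lemma W_trivial:
  assumes none: "\<And>\<phi>. \<phi> \<in> W0 R \<Longrightarrow> L2norm \<phi> \<noteq> 1" and x: "x \<in> W"
  shows "x = 0"
proof (rule ccontr)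
  assume "x \<noteq> 0"
  have "x /\<^sub>R norm x \<in> W" using subspace_scale[OF subspace_W x] .
  then obtain \<phi> where \<phi>: "\<phi> \<in> W0 R" "x /\<^sub>R norm x = lsq_of \<phi>" by (auto simp: W_def)
  have "norm (lsq_of \<phi>) = 1" using \<open>x \<noteq> 0\<close> by (simp flip: \<phi>(2))
  then show False
    using none[OF \<phi>(1)] \<phi>(1) by (simp add: L2norm_def norm_eq_sqrt_inner inner_lsq_of W0_L2)
qed

section \<open>The exact solution and the iterates\<close>

lemma energy_norm_R:
  assumes "\<phi> \<in> W0 R" "ae_eq h (R \<phi>)" "h \<in> L2"
  shows "energy_norm a c h = sqrt (op_lsq (lsq_of \<phi>) \<bullet> lsq_of \<phi>)"
proof -
  have "bform a c (R \<phi>) (R \<phi>) = bform a c h h"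
    using assms by (intro bform_cong a_Linf c_Linf R_H1 ae_eq_sym[OF assms(2)]) (simp_all add: W0_L2)
  then show ?thesis using assms(1) by (simp add: energy_norm_def inner_op_lsq)
qed

lemma R_diff:
  assumes "\<phi> \<in> L2" "\<psi> \<in> L2"
  shows "ae_eq (R (\<lambda>x. \<phi> x - \<psi> x)) (\<lambda>x. R \<phi> x - R \<psi> x)"
proof -
  have add: "\<forall>\<phi>\<in>L2. \<forall>\<psi>\<in>L2. ae_eq (R (\<lambda>x. \<phi> x + \<psi> x)) (\<lambda>x. R \<phi> x + R \<psi> x)"
    using R_linear unfolding linear_op_def by (elim conjE)
  have "ae_eq (R \<phi>) (\<lambda>x. R (\<lambda>x. \<phi> x - \<psi> x) x + R \<psi> x)"
    using bspec[OF bspec[OF add L2_diff[OF assms]] assms(2)] by simp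
  then show ?thesis unfolding ae_eq_def by eventually_elim simp
qed

text \<open>The iterate for k = 0 is the zero function itself, not \<open>R\<close> applied to it;
  this reconciles the two.\<close>

lemma R_zero: "ae_eq (R (\<lambda>x. 0)) (\<lambda>x. 0)"
  using R_diff[OF L2_zero L2_zero] by (simp add: ae_eq_def)

text \<open>The weak equation tests only with \<open>R \<psi>\<close> for \<psi> in
  \<open>W0\<close>. Since \<open>Rs f\<close> lies in \<open>W0\<close>, so does the defect, which
  can therefore be tested against itself.\<close>

lemma op_lsq_solution:
  assumes f: "f \<in> L2" and Rsf: "Rs f \<in> W0 R" and u: "weak_solution a c f u"
    and w: "w \<in> W0 R" "ae_eq u (R w)"
  shows "op_lsq (lsq_of w) = lsq_of (Rs f)"
proof -
  let ?d = "op_lsq (lsq_of w) - lsq_of (Rs f)"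
  have "?d \<in> W"
    using Rsf by (intro subspace_diff[OF subspace_W] op_lsq_in_W) (simp add: W_def)
  then obtain \<psi> where \<psi>: "\<psi> \<in> W0 R" "?d = lsq_of \<psi>" by (auto simp: W_def)
  have u_H1: "u \<in> H1" using u by (simp add: weak_solution_def H10_H1)
  have "op_lsq (lsq_of w) \<bullet> lsq_of \<psi> = bform a c (R w) (R \<psi>)"
    using w \<psi> by (simp add: inner_op_lsq)
  also have "\<dots> = bform a c u (R \<psi>)"
    using W0_L2[OF w(1)] W0_L2[OF \<psi>(1)] u_H1
    by (intro bform_cong a_Linf c_Linf R_H1 ae_eq_refl ae_eq_sym[OF w(2)]) (simp_all add: H1_L2 R_H1)
  also have "\<dots> = ip f (R \<psi>)"
    using u \<psi>(1) by (simp add: weak_solution_def W0_def)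
  also have "\<dots> = ip (Rs f) \<psi>"
    using R_adjoint f W0_L2[OF \<psi>(1)] unfolding is_adjoint_def by (metis ip_commute)
  finally have "?d \<bullet> lsq_of \<psi> = 0"
    using Rsf \<psi>(1) by (simp add: inner_diff_left inner_lsq_of W0_L2)
  then show ?thesis unfolding \<psi>(2)[symmetric] by simp
qed

text \<open>Closure is pulled back from the subspace \<open>W\<close>, which avoids sums of weak
  derivatives.\<close>

lemma W0_lincomb:
  assumes "\<phi> \<in> W0 R" "\<psi> \<in> W0 R"
  shows "(\<lambda>x. \<phi> x + s * \<psi> x) \<in> W0 R" "(\<lambda>x. \<phi> x - s * \<psi> x) \<in> W0 R"
proof -
  have L2: "\<phi> \<in> L2" "(\<lambda>x. s * \<psi> x) \<in> L2" using assms by (simp_all add: W0_L2 L2_scale)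
  have W: "lsq_of \<phi> \<in> W" "lsq_of (\<lambda>x. s * \<psi> x) \<in> W"
    using assms subspace_scale[OF subspace_W] by (auto simp: lsq_of_scale W0_L2 W_def)
  show "(\<lambda>x. \<phi> x + s * \<psi> x) \<in> W0 R" "(\<lambda>x. \<phi> x - s * \<psi> x) \<in> W0 R"
    using subspace_add[OF subspace_W W] subspace_diff[OF subspace_W W] L2
    by (simp_all flip: lsq_of_in_W_iff add: L2_add L2_diff lsq_of_add lsq_of_diff)
qed

lemma T_in_W0: "\<phi> \<in> L2 \<Longrightarrow> T \<phi> \<in> W0 R"
  using op_lsq_in_W[of "lsq_of \<phi>"] by (simp add: op_lsq_of lsq_of_in_W_iff T_L2)

text \<open>The recursion starts at \<open>Rs f\<close> in \<open>W0\<close> and adds only values of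
  \<open>T\<close>, which stay in \<open>W0\<close>. Hence the form in \<alpha>, written without
  \<open>P\<close>, agrees with the form of \<open>T\<close>.\<close>

lemma pcg_in_W0:
  assumes "Rs f \<in> W0 R" "pcg a c R Rs T f k = (v, r, p)"
  shows "v \<in> W0 R \<and> r \<in> W0 R \<and> p \<in> W0 R"
  using assms(2)
proof (induction k arbitrary: v r p)
  case 0
  have "(\<lambda>x. 0) \<in> W0 R"
    using subspace_0[OF subspace_W] lsq_of_in_W_iff[OF L2_zero] by (simp add: lsq_of_zero)
  then show ?case using 0 assms(1) by auto
next
  case (Suc k)
  obtain v' r' p' where prev: "pcg a c R Rs T f k = (v', r', p')" by (cases "pcg a c R Rs T f k")
  then show ?case
    using Suc
    by (auto simp: Let_def simp del: times_divide_eq_left intro!: W0_lincomb T_in_W0 intro: W0_L2)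
qed

lemma pcg_error_bound:
  fixes k :: nat
  assumes f: "f \<in> L2" and Rsf: "Rs f \<in> W0 R" and u: "weak_solution a c f u"
    and w: "w \<in> W0 R" "ae_eq u (R w)" and sb: "spectral_bounds op_lsq W m M"
  defines "e \<equiv> lsq_of w" and "d \<equiv> lsq_of w - lsq_of (fst (pcg a c R Rs T f k))"
  shows "sqrt (op_lsq d \<bullet> d)
    \<le> 2 * ((sqrt M - sqrt m) / (sqrt M + sqrt m)) ^ k * sqrt (op_lsq e \<bullet> e)"
proof -
  define v where "v = (\<lambda>k. fst (pcg a c R Rs T f k))"
  define r where "r = (\<lambda>k. fst (snd (pcg a c R Rs T f k)))"
  define p where "p = (\<lambda>k. snd (snd (pcg a c R Rs T f k)))"
  define \<alpha> where "\<alpha> = (\<lambda>k. ip (r k) (r k) / bform a c (R (p k)) (R (p k)))"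
  define \<beta> where "\<beta> = (\<lambda>k. ip (r (Suc k)) (r (Suc k)) / ip (r k) (r k))"
  have W0: "v k \<in> W0 R" "r k \<in> W0 R" "p k \<in> W0 R" for k
    using pcg_in_W0[OF Rsf, of k "v k" "r k" "p k"] by (simp_all add: v_def r_def p_def)
  note L2 = W0[THEN W0_L2]
  have v_Suc: "v (Suc k) = (\<lambda>x. v k x + \<alpha> k * p k x)" for k
    by (cases "pcg a c R Rs T f k") (simp add: v_def r_def p_def \<alpha>_def Let_def)
  have r_Suc: "r (Suc k) = (\<lambda>x. r k x - \<alpha> k * T (p k) x)" for k
    by (cases "pcg a c R Rs T f k") (simp add: v_def r_def p_def \<alpha>_def Let_def)
  have p_Suc: "p (Suc k) = (\<lambda>x. r (Suc k) x + \<beta> k * p k x)" for k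
    by (cases "pcg a c R Rs T f k") (simp add: v_def r_def p_def \<beta>_def Let_def)
  have sol: "op_lsq e = lsq_of (Rs f)"
    unfolding e_def by (rule op_lsq_solution[OF f Rsf u w])
  have "sqrt (op_lsq (e - lsq_of (v k)) \<bullet> (e - lsq_of (v k)))
    \<le> 2 * ((sqrt M - sqrt m) / (sqrt M + sqrt m)) ^ k * sqrt (op_lsq e \<bullet> e)"
  proof (rule spectral_bounds.cg_error_bound[OF sb,
        where v = "\<lambda>k. lsq_of (v k)" and r = "\<lambda>k. lsq_of (r k)" and p = "\<lambda>k. lsq_of (p k)"
          and \<alpha> = \<alpha> and \<beta> = \<beta>])
    show "e \<in> W" using w(1) by (simp add: e_def W_def)
    show "lsq_of (v 0) = 0" by (simp add: v_def lsq_of_zero)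
    show "lsq_of (r 0) = op_lsq e" "lsq_of (p 0) = op_lsq e" by (simp_all add: r_def p_def sol)
    show "\<alpha> k = lsq_of (r k) \<bullet> lsq_of (r k) / (op_lsq (lsq_of (p k)) \<bullet> lsq_of (p k))" for k
      using W0 L2 by (simp add: \<alpha>_def inner_lsq_of inner_op_lsq)
    show "\<beta> k = lsq_of (r (Suc k)) \<bullet> lsq_of (r (Suc k)) / (lsq_of (r k) \<bullet> lsq_of (r k))" for k
      using L2 by (simp add: \<beta>_def inner_lsq_of)
    show "lsq_of (v (Suc k)) = lsq_of (v k) + \<alpha> k *\<^sub>R lsq_of (p k)" for k
      unfolding v_Suc using L2 by (simp add: lsq_of_add lsq_of_scale L2_scale)
    show "lsq_of (r (Suc k)) = lsq_of (r k) - \<alpha> k *\<^sub>R op_lsq (lsq_of (p k))" for k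
      unfolding r_Suc using L2 by (simp add: lsq_of_diff lsq_of_scale L2_scale op_lsq_of T_L2)
    show "lsq_of (p (Suc k)) = lsq_of (r (Suc k)) + \<beta> k *\<^sub>R lsq_of (p k)" for k
      unfolding p_Suc using L2 by (simp add: lsq_of_add lsq_of_scale L2_scale)
  qed
  then show ?thesis by (simp add: d_def e_def v_def)
qed

end

theorem corollary2p8:
  fixes a c f u :: "real \<Rightarrow> real"
    and R Rs P T :: "(real \<Rightarrow> real) \<Rightarrow> (real \<Rightarrow> real)"
    and k :: nat
  assumes a_Linf: "a \<in> Linf" and a_pos: "AE x in lebesgue_on Omega. a x > 0"
    and c_Linf: "c \<in> Linf" and c_nonneg: "AE x in lebesgue_on Omega. c x \<ge> 0"
    and f_L2: "f \<in> L2"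
    and R_linear: "linear_op R"
    and R_adjoint: "is_adjoint R Rs"
    and R_bounded: "bounded_op R"
    and R_smoother: "smoother R Rs"
    and R_laplacian: "laplacian_preconditioner R"
    and P_proj: "is_orth_proj (W0 R) P"
    and T_op: "is_precond_op a c R P T"
    and Rsf: "Rs f \<in> W0 R"
    and u_solution: "weak_solution a c f u"
    and u_range: "\<exists>v\<in>W0 R. ae_eq u (R v)"
  shows "energy_norm a c (\<lambda>x. u x - pcg_iterate a c R Rs T f k x)
           \<le> 2 * cg_factor (restricted_cond a c R) ^ k * energy_norm a c u"
proof -
  interpret preconditioned_problem a c R Rs P T
    by unfold_locales (fact assms)+
  obtain w where w: "w \<in> W0 R" "ae_eq u (R w)" using u_range by blast
  define v where "v = fst (pcg a c R Rs T f k)"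
  define it where "it = pcg_iterate a c R Rs T f k"
  have v: "v \<in> W0 R" using pcg_in_W0[OF Rsf, of k] by (cases "pcg a c R Rs T f k") (auto simp: v_def)
  have wv: "(\<lambda>x. w x - v x) \<in> W0 R" using W0_lincomb(2)[OF w(1) v, of 1] by simp
  have u_L2: "u \<in> L2" using u_solution by (simp add: weak_solution_def H10_H1 H1_L2)
  have it_L2: "it \<in> L2" and it: "ae_eq it (R v)"
    using H1_L2[OF R_H1[OF W0_L2[OF v]]] L2_zero R_zero
    by (auto simp: it_def pcg_iterate_def v_def ae_eq_refl intro: ae_eq_sym)
  have error: "ae_eq (\<lambda>x. u x - it x) (R (\<lambda>x. w x - v x))"
    using w(2) it R_diff[OF W0_L2[OF w(1)] W0_L2[OF v]]
    unfolding ae_eq_def by eventually_elim simp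
  define d where "d = lsq_of w - lsq_of v"
  have norm_error: "energy_norm a c (\<lambda>x. u x - it x) = sqrt (op_lsq d \<bullet> d)"
    using energy_norm_R[OF wv error] u_L2 it_L2 w(1) v by (simp add: d_def L2_diff lsq_of_diff W0_L2)
  have norm_u: "energy_norm a c u = sqrt (op_lsq (lsq_of w) \<bullet> lsq_of w)"
    by (rule energy_norm_R[OF w u_L2])
  show ?thesis
  proof (cases "\<exists>\<phi>\<in>W0 R. L2norm \<phi> = 1")
    case True
    then obtain \<phi> where "\<phi> \<in> W0 R" "L2norm \<phi> = 1" by blast
    then obtain m M where sb: "spectral_bounds op_lsq W m M"
      and factor: "cg_factor (restricted_cond a c R) = (sqrt M - sqrt m) / (sqrt M + sqrt m)"
      by (rule cg_factor_restricted_cond)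
    show ?thesis
      using pcg_error_bound[OF f_L2 Rsf u_solution w sb, of k] norm_error norm_u
      by (simp add: factor d_def v_def it_def)
  next
    case False
    \<comment> \<open>Without unit vectors the supremum and infimum range over the empty set and the
      factor carries no information, but both energy norms are 0.\<close>
    then have "lsq_of w = 0" "lsq_of v = 0" 
      using w(1) v by (blast intro: W_trivial lsq_of_in_W_iff[THEN iffD2] W0_L2)+
    then show ?thesis using norm_error norm_u by (simp add: d_def it_def)
  qed
qed

end
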